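(* Let $N\ge2$, $\mathsf{A}=(A_1,\ldots,A_N)\in GL_d(\mathbb{R})^N$ and $0<s<d$. Suppose there exist positive integers $d_1,\ldots,d_\ell$ and real matrices $A_i^{(j,k)}$ such that $\sum_{i=1}^\ell d_i=d$ and $$A_i=\begin{pmatrix}A_i^{(1,1)}&A_i^{(1,2)}&\cdots&A_i^{(1,\ell)}\\0&A_i^{(2,2)}&\cdots&A_i^{(2,\ell)}\\\vdots&\vdots&\ddots&\vdots\\0&0&\cdots&A_i^{(\ell,\ell)}\end{pmatrix}$$ for all $i\in\{1,\ldots,N\}$, where each matrix $A_i^{(j,k)}$ has dimension $d_j\times d_k$. Then the set of $\varphi^s$-equilibrium states of $\mathsf{A}$ is precisely the set of $\varphi^s$-equilibrium states of $\mathsf{A}'=(A_1',\ldots,A_N')\in GL_d(\mathbb{R})^N$ defined by $$A_i'=\begin{pmatrix}A_i^{(1,1)}&0&\cdots&0\\0&A_i^{(2,2)}&\cdots&0\\\vdots&\vdots&\ddots&\vdots\\0&0&\cdots&A_i^{(\ell,\ell)}\end{pmatrix}$$ for all $i\in\{1,\ldots,N\}$.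
   Context: Let $\Sigma=\{1,\ldots,N\}^{\mathbb{N}}$ with the product topology, and $\sigma\colon\Sigma\to\Sigma$, $\sigma(i_1i_2i_3\cdots)=i_2i_3\cdots$. Let $\Sigma_n=\{1,\ldots,N\}^n$. For a finite word $\mathtt{i}$ the cylinder $[\mathtt{i}]\subset\Sigma$ is the set of infinite words beginning with $\mathtt{i}$. $\mathcal{M}_\sigma(\Sigma)$ is the set of $\sigma$-invariant Borel probability measures on $\Sigma$. For $A\in GL_d(\mathbb{R})$ with singular values $\alpha_1(A)\ge\cdots\ge\alpha_d(A)>0$, the singular value function is $\varphi^s(A)=\alpha_1(A)\cdots\alpha_k(A)\,\alpha_{k+1}(A)^{s-k}$ for $k\in\{0,\ldots,d-1\}$ and $k\le s<k+1$. For $\mathsf{A}=(A_1,\ldots,A_N)\in GL_d(\mathbb{R})^N$ and $\mathtt{i}=i_1\cdots i_n$ write $A_{\mathtt{i}}=A_{i_1}\cdots A_{i_n}$. Define $P_{\mathsf{A}}(\varphi^s)=\lim_{n\to\infty}\frac1n\log\sum_{\mathtt{i}\in\Sigma_n}\varphi^s(A_{\mathtt{i}})$, and for $\mu\in\mathcal{M}_\sigma(\Sigma)$ define $h(\mu)=\lim_{n\to\infty}\frac1n\sum_{\mathtt{i}\in\Sigma_n}-\mu([\mathtt{i}])\log\mu([\mathtt{i}])$ and $\lambda_{\mathsf{A}}(\varphi^s,\mu)=\lim_{n\to\infty}\frac1n\sum_{\mathtt{i}\in\Sigma_n}\mu([\mathtt{i}])\log\varphi^s(A_{\mathtt{i}})$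 (limits exist by subadditivity). $\mu\in\mathcal{M}_\sigma(\Sigma)$ is a $\varphi^s$-equilibrium state of $\mathsf{A}$ if $P_{\mathsf{A}}(\varphi^s)=h(\mu)+\lambda_{\mathsf{A}}(\varphi^s,\mu)$. *)

theory Defs
  imports
    "HOL-Probability.Probability"
    "Jordan_Normal_Form.Char_Poly"
begin

definition seq_topology :: "nat \<Rightarrow> (nat \<Rightarrow> nat) topology" where
  "seq_topology N = product_topology (\<lambda>_. discrete_topology {1..N}) UNIV"

definition seqs :: "nat \<Rightarrow> (nat \<Rightarrow> nat) set" where
  "seqs N = topspace (seq_topology N)"

definition seq_borel :: "nat \<Rightarrow> (nat \<Rightarrow> nat) measure" where
  "seq_borel N = sigma (seqs N) {U. openin (seq_topology N) U}"

definition left_shift :: "(nat \<Rightarrow> nat) \<Rightarrow> nat \<Rightarrow> nat" where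
  "left_shift \<omega> = (\<lambda>n. \<omega> (Suc n))"

definition invariant_measures :: "nat \<Rightarrow> (nat \<Rightarrow> nat) measure set" where
  "invariant_measures N =
     {\<mu>. prob_space \<mu> \<and> sets \<mu> = sets (seq_borel N) \<and>
         left_shift \<in> measurable \<mu> \<mu> \<and> distr \<mu> \<mu> left_shift = \<mu>}"

definition words :: "nat \<Rightarrow> nat \<Rightarrow> nat list set" where
  "words N n = {w. length w = n \<and> set w \<subseteq> {1..N}}"

definition cylinder :: "nat \<Rightarrow> nat list \<Rightarrow> (nat \<Rightarrow> nat) set" where
  "cylinder N w = {\<omega> \<in> seqs N. \<forall>k<length w. \<omega> k = w ! k}"

definition GL :: "nat \<Rightarrow> real mat set" where
  "GL d = {A \<in> carrier_mat d d. invertible_mat A}"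

text \<open>All singular values in decreasing order, repeated according to the multiplicities of their
  squares as eigenvalues of the Gram matrix.\<close>

definition singular_values :: "real mat \<Rightarrow> real list" where
  "singular_values A =
     rev (sorted_list_of_multiset (image_mset sqrt (proots (char_poly (transpose_mat A * A)))))"

definition singular_value :: "real mat \<Rightarrow> nat \<Rightarrow> real" where
  "singular_value A i = singular_values A ! (i - 1)"

text \<open>Only meant for \<open>0 \<le> s < d\<close> and invertible \<open>d \<times> d\<close> matrices.\<close>

definition svf :: "real \<Rightarrow> real mat \<Rightarrow> real" where
  "svf s A = (let k = nat \<lfloor>s\<rfloor> in
     (\<Prod>i=1..k. singular_value A i) * singular_value A (k + 1) powr (s - real k))"

definition word_mat :: "nat \<Rightarrow> (nat \<Rightarrow> real mat) \<Rightarrow> nat list \<Rightarrow> real mat" where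
  "word_mat d A w = foldr (\<lambda>i M. A i * M) w (1\<^sub>m d)"

definition pressure :: "nat \<Rightarrow> nat \<Rightarrow> real \<Rightarrow> (nat \<Rightarrow> real mat) \<Rightarrow> real" where
  "pressure N d s A =
     lim (\<lambda>n. 1 / real n * ln (\<Sum>w\<in>words N n. svf s (word_mat d A w)))"

text \<open>The convention \<open>0 log 0 = 0\<close> is built into \<^term>\<open>ln 0 = (0::real)\<close>.\<close>

definition shift_entropy :: "nat \<Rightarrow> (nat \<Rightarrow> nat) measure \<Rightarrow> real" where
  "shift_entropy N \<mu> =
     lim (\<lambda>n. 1 / real n *
       (\<Sum>w\<in>words N n. - measure \<mu> (cylinder N w) * ln (measure \<mu> (cylinder N w))))"

definition lyapunov ::
    "nat \<Rightarrow> nat \<Rightarrow> real \<Rightarrow> (nat \<Rightarrow> real mat) \<Rightarrow> (nat \<Rightarrow> nat) measure \<Rightarrow> real" where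
  "lyapunov N d s A \<mu> =
     lim (\<lambda>n. 1 / real n *
       (\<Sum>w\<in>words N n. measure \<mu> (cylinder N w) * ln (svf s (word_mat d A w))))"

definition equilibrium_states ::
    "nat \<Rightarrow> nat \<Rightarrow> real \<Rightarrow> (nat \<Rightarrow> real mat) \<Rightarrow> (nat \<Rightarrow> nat) measure set" where
  "equilibrium_states N d s A =
     {\<mu> \<in> invariant_measures N. pressure N d s A = shift_entropy N \<mu> + lyapunov N d s A \<mu>}"

text \<open>Blocks are numbered from \<open>0\<close>; block \<open>j\<close> occupies the rows (columns) starting at
  \<open>block_offset ds j\<close>, of which there are \<open>ds ! j\<close>.\<close>

definition block_offset :: "nat list \<Rightarrow> nat \<Rightarrow> nat" where
  "block_offset ds j = sum_list (take j ds)"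

definition block_index :: "nat list \<Rightarrow> nat \<Rightarrow> nat" where
  "block_index ds r = (LEAST j. r < block_offset ds (Suc j))"

definition block_mat :: "nat list \<Rightarrow> (nat \<Rightarrow> nat \<Rightarrow> real mat) \<Rightarrow> real mat" where
  "block_mat ds F = mat (sum_list ds) (sum_list ds) (\<lambda>(r, c).
     let j = block_index ds r; k = block_index ds c
     in F j k $$ (r - block_offset ds j, c - block_offset ds k))"

lemma block_offset_mono: "i \<le> j \<Longrightarrow> block_offset ds i \<le> block_offset ds j"
proof -
  assume "i \<le> j"
  then have "take j ds = take i ds @ take (j - i) (drop i ds)"
    by (metis le_add_diff_inverse take_add)
  then show ?thesis by (simp add: block_offset_def)
qed

lemma block_offset_Suc: "j < length ds \<Longrightarrow> block_offset ds (Suc j) = block_offset ds j + ds ! j"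
  by (simp add: block_offset_def take_Suc_conv_app_nth)

lemma block_index_offset:
  assumes "j < length ds" "a < ds ! j"
  shows "block_index ds (block_offset ds j + a) = j"
  unfolding block_index_def
proof (rule Least_equality)
  show "block_offset ds j + a < block_offset ds (Suc j)"
    using assms by (simp add: block_offset_Suc)
next
  fix y assume y: "block_offset ds j + a < block_offset ds (Suc y)"
  show "j \<le> y"
  proof (rule ccontr)
    assume "\<not> j \<le> y"
    then have "block_offset ds (Suc y) \<le> block_offset ds j" by (intro block_offset_mono) simp
    with y show False by simp
  qed
qed

lemma block_mat_index:
  assumes "j < length ds" "a < ds ! j" "k < length ds" "b < ds ! k"
  shows "block_mat ds F $$ (block_offset ds j + a, block_offset ds k + b) = F j k $$ (a, b)"
proof -
  have bound: "block_offset ds i + c < sum_list ds" if "i < length ds" "c < ds ! i" for i c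
  proof -
    have "block_offset ds (Suc i) \<le> block_offset ds (length ds)"
      using that by (intro block_offset_mono) simp
    then show ?thesis using that block_offset_Suc[of i ds] by (simp add: block_offset_def)
  qed
  show ?thesis
    using assms bound by (simp add: block_mat_def block_index_offset Let_def)
qed

end

theory Submission
  imports Defs "Jordan_Normal_Form.Schur_Decomposition"
begin

text \<open>
  An equilibrium state is defined by an identity between the pressure, the entropy and the Lyapunov
  exponent, and the entropy does not involve the matrices. So it suffices that \<open>A\<close> and its block
  diagonal part \<open>A'\<close> have the same pressure and, for every invariant measure, the same Lyapunov
  exponent. Both quantities are exponential growth rates of an average of the singular value function
  over the words of length \<open>n\<close>. For a single word the two values may differ by an exponentially large
  factor, because an off-diagonal entry of a product can grow under one block for half of
  the word and under another block for the other half; only the averages agree.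

  One inequality is pointwise: every minor of the block diagonal part of a block triangular matrix is
  either the same minor of the matrix itself or zero (\<open>minor_diagonal_part_eq\<close>,
  \<open>minor_diagonal_part_zero\<close>). In particular the determinants agree, so \<open>A'\<close> is invertible. For the other inequality, conjugate all matrices with the diagonal
  matrix that has the entry \<open>t ^ j\<close> on the block \<open>j\<close>. For fixed \<open>t > 0\<close> this changes the singular value
  function by a bounded factor, uniformly in the word, hence no growth rate changes. As
  \<open>t\<close> tends to \<open>0\<close>, the conjugated matrices tend to the block diagonal part. The averages are
  submultiplicative, so the growth rate of the conjugated system is at most its average at any
  fixed length \<open>n\<close>, and for small \<open>t\<close> this is at most the average of the block diagonal
  system at length \<open>n\<close> plus an error. This upper semicontinuity is isolated in \<open>subadditive_squeeze\<close>, which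
  compares convergence of two sequences without proving that either converges; that is enough since
  pressure and Lyapunov exponent are given by \<open>lim\<close>, a description operator.

  The singular value function itself is inconvenient here, so it is replaced by sums of squares
  of minors. The sum of the squares of all \<open>k\<close>-minors of \<open>X\<close> is, by the Cauchy--Binet formula and
  triangularization of the Gram matrix, comparable to the squared product of the \<open>k\<close> largest
  singular values (\<open>singular_values_minors\<close>), it is submultiplicative (\<open>minors_sq_mult\<close>) and it is
  visibly continuous. The singular value function is a weighted geometric mean of the products of the
  \<open>k\<close> and of the \<open>k + 1\<close> largest singular values, which gives the comparison
  \<open>ln_svf_log_minors\<close>.
\<close>

section \<open>Minors and the Cauchy--Binet formula\<close>

text \<open>
  Rows and columns of a minor are selected by arbitrary tuples of indices, neither increasing nor
  injective. Every ordinary minor then occurs many times up to sign, which costs only factors depending on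
  \<open>k\<close>, and in return sums over selections are sums over a full function space.
\<close>

definition index_tuples :: "nat \<Rightarrow> nat \<Rightarrow> (nat \<Rightarrow> nat) set" where
  "index_tuples k d = {0..<k} \<rightarrow>\<^sub>E {0..<d}"

definition minor :: "nat \<Rightarrow> real mat \<Rightarrow> (nat \<Rightarrow> nat) \<Rightarrow> (nat \<Rightarrow> nat) \<Rightarrow> real" where
  "minor k X f g = det (mat k k (\<lambda>(i, j). X $$ (f i, g j)))"

lemma finite_index_tuples [simp]: "finite (index_tuples k d)"
  by (simp add: index_tuples_def finite_PiE)

lemma index_tuples_lt: "f \<in> index_tuples k d \<Longrightarrow> i < k \<Longrightarrow> f i < d"
  by (auto simp: index_tuples_def PiE_iff)

lemma minor_leibniz:
  "minor k X f g = (\<Sum>p | p permutes {0..<k}. signof p * (\<Prod>i = 0..<k. X $$ (f i, g (p i))))"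
proof -
  have "(\<Prod>i = 0..<k. mat k k (\<lambda>(i, j). X $$ (f i, g j)) $$ (i, p i)) =
        (\<Prod>i = 0..<k. X $$ (f i, g (p i)))" if "p permutes {0..<k}" for p
    using permutes_in_image[OF that] by (intro prod.cong) auto
  then show ?thesis
    unfolding minor_def by (subst det_def'[of _ k]) (auto intro!: sum.cong)
qed

lemma minor_permute_rows:
  assumes "q permutes {0..<k}"
  shows "minor k X (f \<circ> q) g = signof q * minor k X f g"
proof -
  have "mat k k (\<lambda>(i, j). X $$ ((f \<circ> q) i, g j)) =
        mat k k (\<lambda>(i, j). mat k k (\<lambda>(i, j). X $$ (f i, g j)) $$ (q i, j))"
    using permutes_in_image[OF assms] by (intro eq_matI) auto
  then show ?thesis
    unfolding minor_def by (simp add: det_permute_rows[OF _ assms])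
qed

lemma minor_not_inj:
  assumes "\<not> inj_on f {0..<k}"
  shows "minor k X f g = 0"
proof -
  obtain i j where ij: "i < k" "j < k" "i \<noteq> j" "f i = f j"
    using assms by (auto simp: inj_on_def)
  show ?thesis
    unfolding minor_def
    by (rule det_identical_rows[of _ k i j]) (use ij in \<open>auto intro!: eq_vecI\<close>)
qed

lemma minor_transpose:
  assumes "X \<in> carrier_mat d d" "\<And>i. i < k \<Longrightarrow> f i < d" "\<And>i. i < k \<Longrightarrow> g i < d"
  shows "minor k (transpose_mat X) f g = minor k X g f"
proof -
  have "mat k k (\<lambda>(i, j). transpose_mat X $$ (f i, g j)) =
        transpose_mat (mat k k (\<lambda>(i, j). X $$ (g i, f j)))"
    using assms by (intro eq_matI) auto
  then show ?thesis
    unfolding minor_def by (simp add: det_transpose[of _ k])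
qed

text \<open>
  Multilinearity expands the minor over all tuples \<open>h\<close>, but with a plain product of entries of
  \<open>X\<close> in place of a minor of \<open>X\<close>. Reindexing \<open>h\<close> by a permutation and averaging over all permutations
  turns that product into the determinant; the factor \<open>fact k\<close> counts the permutations.
\<close>

lemma cauchy_binet:
  assumes X: "X \<in> carrier_mat d d" and Y: "Y \<in> carrier_mat d d"
    and f: "\<And>i. i < k \<Longrightarrow> f i < d" and g: "\<And>i. i < k \<Longrightarrow> g i < d"
  shows "fact k * minor k (X * Y) f g = (\<Sum>h\<in>index_tuples k d. minor k X f h * minor k Y h g)"
proof -
  have expand: "minor k (X * Y) f g =
      (\<Sum>h\<in>index_tuples k d. (\<Prod>i = 0..<k. X $$ (f i, h i)) * minor k Y h g)"
  proof -
    have "(\<Prod>i = 0..<k. (X * Y) $$ (f i, g (p i))) =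
        (\<Sum>h\<in>index_tuples k d. (\<Prod>i = 0..<k. X $$ (f i, h i)) * (\<Prod>i = 0..<k. Y $$ (h i, g (p i))))"
      if p: "p permutes {0..<k}" for p
    proof -
      have "(\<Prod>i = 0..<k. (X * Y) $$ (f i, g (p i))) =
          (\<Prod>i = 0..<k. \<Sum>m = 0..<d. X $$ (f i, m) * Y $$ (m, g (p i)))"
        using X Y f g permutes_in_image[OF p] by (intro prod.cong) (auto simp: scalar_prod_def)
      also have "\<dots> = (\<Sum>h\<in>index_tuples k d. \<Prod>i = 0..<k. X $$ (f i, h i) * Y $$ (h i, g (p i)))"
        unfolding index_tuples_def by (rule prod_sum_PiE) auto
      finally show ?thesis by (simp add: prod.distrib)
    qed
    then have "minor k (X * Y) f g = (\<Sum>p | p permutes {0..<k}. \<Sum>h\<in>index_tuples k d.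
        signof p * ((\<Prod>i = 0..<k. X $$ (f i, h i)) * (\<Prod>i = 0..<k. Y $$ (h i, g (p i)))))"
      by (simp add: minor_leibniz sum_distrib_left)
    also have "\<dots> = (\<Sum>h\<in>index_tuples k d. \<Sum>p | p permutes {0..<k}.
        signof p * ((\<Prod>i = 0..<k. X $$ (f i, h i)) * (\<Prod>i = 0..<k. Y $$ (h i, g (p i)))))"
      by (rule sum.swap)
    finally show ?thesis
      by (simp add: minor_leibniz sum_distrib_left mult.left_commute)
  qed
  have permuted: "minor k (X * Y) f g = (\<Sum>h\<in>index_tuples k d.
      signof q * (\<Prod>i = 0..<k. X $$ (f i, h (q i))) * minor k Y h g)"
    if q: "q permutes {0..<k}" for q
  proof -
    have mem: "h \<circ> r \<in> index_tuples k d"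
      if "h \<in> index_tuples k d" "r permutes {0..<k}" for h r
      using that permutes_in_image[OF that(2)] permutes_not_in[OF that(2)]
      unfolding index_tuples_def by (auto simp: PiE_iff extensional_def)
    have "bij_betw (\<lambda>h. h \<circ> q) (index_tuples k d) (index_tuples k d)"
    proof (rule bij_betwI[where g = "\<lambda>h. h \<circ> inv_into UNIV q"])
      show "(\<lambda>h. h \<circ> q) \<in> index_tuples k d \<rightarrow> index_tuples k d"
        using mem q by blast
      show "(\<lambda>h. h \<circ> inv_into UNIV q) \<in> index_tuples k d \<rightarrow> index_tuples k d"
        using mem permutes_inv[OF q] by blast
    qed (simp_all only: comp_assoc permutes_inv_o[OF q] comp_id)
    then have "minor k (X * Y) f g = (\<Sum>h\<in>index_tuples k d.
        (\<Prod>i = 0..<k. X $$ (f i, (h \<circ> q) i)) * minor k Y (h \<circ> q) g)"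
      unfolding expand by (rule sum.reindex_bij_betw[symmetric])
    then show ?thesis
      by (simp add: minor_permute_rows[OF q] mult_ac)
  qed
  have "fact k * minor k (X * Y) f g = (\<Sum>q | q permutes {0..<k}. minor k (X * Y) f g)"
    by (simp add: card_permutations[of "{0..<k}" k])
  also have "\<dots> = (\<Sum>q | q permutes {0..<k}. \<Sum>h\<in>index_tuples k d.
      signof q * (\<Prod>i = 0..<k. X $$ (f i, h (q i))) * minor k Y h g)"
    using permuted by (intro sum.cong) auto
  also have "\<dots> = (\<Sum>h\<in>index_tuples k d. minor k X f h * minor k Y h g)"
    by (subst sum.swap) (simp add: minor_leibniz[of k X] sum_distrib_right)
  finally show ?thesis .
qed

text \<open>
  Up to the factor \<open>(fact k)\<^sup>2\<close>, this is the squared Hilbert--Schmidt norm of the \<open>k\<close>-th exterior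
  power of \<open>X\<close>.
\<close>

definition minors_sq :: "nat \<Rightarrow> nat \<Rightarrow> real mat \<Rightarrow> real" where
  "minors_sq d k X = (\<Sum>f\<in>index_tuples k d. \<Sum>g\<in>index_tuples k d. (minor k X f g)\<^sup>2)"

lemma minors_sq_nonneg: "0 \<le> minors_sq d k X"
  by (simp add: minors_sq_def sum_nonneg)

text \<open>
  Cauchy--Binet followed by Cauchy--Schwarz in the summation index: the Hilbert--Schmidt norm is
  submultiplicative.
\<close>

lemma minors_sq_mult:
  assumes X: "X \<in> carrier_mat d d" and Y: "Y \<in> carrier_mat d d"
  shows "minors_sq d k (X * Y) \<le> minors_sq d k X * minors_sq d k Y"
proof -
  let ?T = "index_tuples k d"
  \<comment> \<open>The factor \<open>fact k\<close> of the Cauchy--Binet formula is at least \<open>1\<close> and helps here.\<close>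
  have "(minor k (X * Y) f g)\<^sup>2 \<le> (\<Sum>h\<in>?T. (minor k X f h)\<^sup>2) * (\<Sum>h\<in>?T. (minor k Y h g)\<^sup>2)"
    if "f \<in> ?T" "g \<in> ?T" for f g
  proof -
    have "(minor k (X * Y) f g)\<^sup>2 \<le> (fact k * minor k (X * Y) f g)\<^sup>2"
      by (simp add: power_mult_distrib mult_le_cancel_right1)
    also have "\<dots> = (\<Sum>h\<in>?T. minor k X f h * minor k Y h g)\<^sup>2"
      using cauchy_binet[OF X Y, of k f g] index_tuples_lt that by simp
    also have "\<dots> \<le> (\<Sum>h\<in>?T. (minor k X f h)\<^sup>2) * (\<Sum>h\<in>?T. (minor k Y h g)\<^sup>2)"
      by (rule Cauchy_Schwarz_ineq_sum)
    finally show ?thesis .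
  qed
  then have "minors_sq d k (X * Y) \<le>
      (\<Sum>f\<in>?T. \<Sum>g\<in>?T. (\<Sum>h\<in>?T. (minor k X f h)\<^sup>2) * (\<Sum>h\<in>?T. (minor k Y h g)\<^sup>2))"
    unfolding minors_sq_def by (intro sum_mono) auto
  also have "\<dots> = (\<Sum>f\<in>?T. \<Sum>h\<in>?T. (minor k X f h)\<^sup>2) * (\<Sum>g\<in>?T. \<Sum>h\<in>?T. (minor k Y h g)\<^sup>2)"
    by (simp add: sum_product)
  also have "(\<Sum>g\<in>?T. \<Sum>h\<in>?T. (minor k Y h g)\<^sup>2) = minors_sq d k Y"
    unfolding minors_sq_def by (rule sum.swap)
  finally show ?thesis by (simp add: minors_sq_def)
qed

text \<open>
  Up to the factor \<open>fact k\<close>, this is the trace of the \<open>k\<close>-th exterior power of \<open>X\<close>, equivalently the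
  \<open>k\<close>-th elementary symmetric function of the eigenvalues.
\<close>

definition principal_minors :: "nat \<Rightarrow> nat \<Rightarrow> real mat \<Rightarrow> real" where
  "principal_minors d k X = (\<Sum>f\<in>index_tuples k d. minor k X f f)"

lemma principal_minors_commute:
  assumes X: "X \<in> carrier_mat d d" and Y: "Y \<in> carrier_mat d d"
  shows "principal_minors d k (X * Y) = principal_minors d k (Y * X)"
proof -
  let ?T = "index_tuples k d"
  have *: "fact k * principal_minors d k (U * V) = (\<Sum>f\<in>?T. \<Sum>h\<in>?T. minor k U f h * minor k V h f)"
    if "U \<in> carrier_mat d d" "V \<in> carrier_mat d d" for U V
    unfolding principal_minors_def sum_distrib_left
    using cauchy_binet[OF that] index_tuples_lt by (intro sum.cong) auto
  have "fact k * principal_minors d k (X * Y) = fact k * principal_minors d k (Y * X)"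
    unfolding *[OF X Y] *[OF Y X] by (subst sum.swap) (simp add: mult.commute)
  then show ?thesis by simp
qed

lemma principal_minors_similar:
  assumes "similar_mat_wit X Y P Q" and X: "X \<in> carrier_mat d d"
  shows "principal_minors d k X = principal_minors d k Y"
proof -
  note w = similar_mat_witD2[OF X assms(1)]
  have "principal_minors d k X = principal_minors d k (P * (Y * Q))"
    using w by (simp add: assoc_mult_mat[of P d d Y d Q d])
  also have "\<dots> = principal_minors d k (Y * Q * P)"
    using w by (intro principal_minors_commute) auto
  also have "Y * Q * P = Y"
    using w by (simp add: assoc_mult_mat[of Y d d Q d P d])
  finally show ?thesis .
qed

lemma minors_sq_gram:
  assumes X: "X \<in> carrier_mat d d"
  shows "minors_sq d k X = fact k * principal_minors d k (transpose_mat X * X)"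
proof -
  let ?T = "index_tuples k d"
  have "fact k * principal_minors d k (transpose_mat X * X) =
      (\<Sum>f\<in>?T. \<Sum>h\<in>?T. minor k (transpose_mat X) f h * minor k X h f)"
    unfolding principal_minors_def sum_distrib_left
    using cauchy_binet[of "transpose_mat X" d X] X index_tuples_lt by (intro sum.cong) auto
  also have "\<dots> = (\<Sum>f\<in>?T. \<Sum>h\<in>?T. (minor k X h f)\<^sup>2)"
    using minor_transpose[OF X] index_tuples_lt
    by (intro sum.cong) (auto simp: power2_eq_square)
  also have "\<dots> = minors_sq d k X"
    unfolding minors_sq_def by (rule sum.swap)
  finally show ?thesis by simp
qed

text \<open>
  A permutation contributing to the Leibniz expansion must satisfy \<open>f i \<le> f (p i)\<close> for all \<open>i\<close>.
  Both sides have the same sum over \<open>i\<close>, so equality holds throughout, and \<open>p\<close> is the identity because \<open>f\<close> is injective.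
\<close>

lemma minor_upper_triangular:
  assumes T: "T \<in> carrier_mat d d" "upper_triangular T" and f: "f \<in> index_tuples k d" "inj_on f {0..<k}"
  shows "minor k T f f = (\<Prod>i = 0..<k. T $$ (f i, f i))"
proof -
  have "signof p * (\<Prod>i = 0..<k. T $$ (f i, f (p i))) = 0"
    if p: "p permutes {0..<k}" "p \<noteq> id" for p
  proof -
    have "\<exists>i<k. f (p i) < f i"
    proof (rule ccontr)
      assume "\<not> ?thesis"
      then have le: "f i \<le> f (p i)" if "i < k" for i using that by force
      have "(\<Sum>i = 0..<k. f (p i)) = (\<Sum>i = 0..<k. f i)"
        using sum.permute[OF p(1), of f] by (simp add: comp_def)
      then have "f i = f (p i)" if "i < k" for i
        using sum_mono_inv[of f "{0..<k}" "\<lambda>i. f (p i)" i] le that by simp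
      then have "p i = i" if "i < k" for i
        using inj_onD[OF f(2), of i "p i"] that permutes_in_image[OF p(1), of i] by simp
      moreover have "p i = i" if "\<not> i < k" for i
        using permutes_not_in[OF p(1), of i] that by simp
      ultimately have "p = id" by (intro ext) (metis id_apply)
      with p(2) show False ..
    qed
    then obtain i where i: "i < k" "f (p i) < f i" by blast
    then have "T $$ (f i, f (p i)) = 0"
      using T index_tuples_lt[OF f(1)] by (auto simp: upper_triangular_def)
    then show ?thesis using i by auto
  qed
  then have "minor k T f f = (\<Sum>p\<in>{id}. signof p * (\<Prod>i = 0..<k. T $$ (f i, f (p i))))"
    unfolding minor_leibniz
    by (intro sum.mono_neutral_right) (auto simp: finite_permutations permutes_id)
  then show ?thesis by simp
qed

lemma principal_minors_upper_triangular:
  assumes T: "T \<in> carrier_mat d d" "upper_triangular T"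
  shows "principal_minors d k T =
    (\<Sum>f | f \<in> index_tuples k d \<and> inj_on f {0..<k}. \<Prod>i = 0..<k. T $$ (f i, f i))"
proof -
  have "principal_minors d k T =
    (\<Sum>f | f \<in> index_tuples k d \<and> inj_on f {0..<k}. minor k T f f)"
    unfolding principal_minors_def
    by (intro sum.mono_neutral_right) (auto simp: minor_not_inj)
  then show ?thesis using minor_upper_triangular[OF T] by (auto intro!: sum.cong)
qed

section \<open>Minors and singular values\<close>

text \<open>
  For an eigenvector \<open>v\<close>, pairing the eigenvalue equation with \<open>v\<close> gives
  \<open>e * \<parallel>v\<parallel>\<^sup>2 = \<parallel>X v\<parallel>\<^sup>2\<close>. In the partial order on complex numbers the conclusion also says that \<open>e\<close> is real.
\<close>

lemma gram_eigenvalue_nonneg: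
  fixes X :: "real mat"
  assumes X: "X \<in> carrier_mat d d"
    and e: "eigenvalue (map_mat complex_of_real (transpose_mat X * X)) e"
  shows "0 \<le> e"
proof -
  define Y where "Y = map_mat complex_of_real X"
  have Y: "Y \<in> carrier_mat d d" using X by (simp add: Y_def)
  have G: "map_mat complex_of_real (transpose_mat X * X) = transpose_mat Y * Y"
    unfolding Y_def using X
    by (simp add: of_real_hom.mat_hom_mult[of _ d d _ d] map_mat_transpose)
  obtain v where v: "v \<in> carrier_vec d" "v \<noteq> 0\<^sub>v d" "(transpose_mat Y * Y) *\<^sub>v v = e \<cdot>\<^sub>v v"
    using e Y unfolding G eigenvalue_def eigenvector_def by auto
  define w where "w = Y *\<^sub>v v"
  have w: "w \<in> carrier_vec d" using Y v by (simp add: w_def)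
  have conj: "Y *\<^sub>v conjugate v = conjugate w"
  proof (rule eq_vecI)
    fix i assume "i < dim_vec (conjugate w)"
    then have i: "i < d" using w by simp
    have "(\<Sum>j = 0..<d. Y $$ (i, j) * cnj (v $ j)) = cnj (\<Sum>j = 0..<d. Y $$ (i, j) * v $ j)"
      unfolding cnj_sum using i X by (intro sum.cong) (auto simp: Y_def)
    then show "(Y *\<^sub>v conjugate v) $ i = conjugate w $ i"
      using i Y v(1) by (simp add: w_def scalar_prod_def)
  qed (use Y w in auto)
  have "e * (v \<bullet>c v) = (e \<cdot>\<^sub>v v) \<bullet>c v" using v by simp
  also have "\<dots> = (transpose_mat Y *\<^sub>v w) \<bullet>c v"
    using v Y by (simp add: w_def flip: v(3))
  also have "\<dots> = w \<bullet> (Y *\<^sub>v conjugate v)"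
    using transpose_vec_mult_scalar[OF Y, of "conjugate v" w] v w by simp
  also have "\<dots> = w \<bullet>c w" by (simp add: conj)
  finally have eq: "e * (v \<bullet>c v) = w \<bullet>c w" .
  have "0 < v \<bullet>c v" "0 \<le> w \<bullet>c w" using v w by (auto intro: conjugate_square_ge_0_vec)
  with eq have *: "Re e * Re (v \<bullet>c v) = Re (w \<bullet>c w)" "Im e = 0" "0 < Re (v \<bullet>c v)" "0 \<le> Re (w \<bullet>c w)"
    by (auto simp: less_eq_complex_def less_complex_def complex_eq_iff)
  then have "0 \<le> Re e" using mult_neg_pos[of "Re e" "Re (v \<bullet>c v)"] by (cases "Re e < 0") auto
  with * show ?thesis by (simp add: less_eq_complex_def)
qed

text \<open>
  The characteristic polynomial of the Gram matrix splits over the reals, so the list of singular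
  values has full length and real triangularization applies.
\<close>

lemma char_poly_gram_factors:
  fixes X :: "real mat"
  assumes X: "X \<in> carrier_mat d d"
  obtains rs where "length rs = d" "sorted (rev rs)" "\<And>r. r \<in> set rs \<Longrightarrow> 0 \<le> r"
    "char_poly (transpose_mat X * X) = (\<Prod>r\<leftarrow>rs. [:- r, 1:])"
proof -
  define G where "G = transpose_mat X * X"
  have G: "G \<in> carrier_mat d d" using X by (simp add: G_def)
  have GC: "map_mat complex_of_real G \<in> carrier_mat d d" using G by simp
  obtain es where es: "char_poly (map_mat complex_of_real G) = (\<Prod>e\<leftarrow>es. [:- e, 1:])" "length es = d"
    using char_poly_factorized[OF GC] by blast
  have nonneg: "0 \<le> e" if "e \<in> set es" for e
  proof (rule gram_eigenvalue_nonneg[OF X, folded G_def])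
    show "eigenvalue (map_mat complex_of_real G) e"
      unfolding eigenvalue_root_char_poly[OF GC] es(1) by (rule linear_poly_root[OF that])
  qed
  define rs where "rs = rev (sort (map Re es))"
  have mset: "mset (map complex_of_real rs) = mset es"
  proof -
    have "map (complex_of_real \<circ> Re) es = map id es"
      using nonneg by (intro map_cong) (auto simp: less_eq_complex_def complex_eq_iff)
    then have "mset (map (complex_of_real \<circ> Re) es) = mset es" by simp
    then show ?thesis by (simp add: rs_def image_mset.compositionality del: map_map)
  qed
  interpret h: map_poly_inj_comm_ring_hom complex_of_real ..
  have "map_poly complex_of_real (char_poly G) = (\<Prod>e\<leftarrow>es. [:- e, 1:])"
    unfolding es(1)[symmetric] by (rule of_real_hom.char_poly_hom[OF G, symmetric])
  also have "\<dots> = (\<Prod>e\<in>#mset es. [:- e, 1:])"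
    by (metis mset_map prod_mset_prod_list)
  also have "\<dots> = (\<Prod>r\<leftarrow>rs. [:- complex_of_real r, 1:])"
    unfolding mset[symmetric] by (simp flip: prod_mset_prod_list add: image_mset.compositionality o_def)
  also have "\<dots> = map_poly complex_of_real (\<Prod>r\<leftarrow>rs. [:- r, 1:])"
    by (simp add: h.hom_prod_list o_def)
  finally have "char_poly G = (\<Prod>r\<leftarrow>rs. [:- r, 1:])" by (rule h.injectivity)
  moreover have "0 \<le> r" if "r \<in> set rs" for r
    using that nonneg by (auto simp: rs_def less_eq_complex_def)
  moreover have "sorted (rev rs)" "length rs = d" by (simp_all add: rs_def es(2))
  ultimately show ?thesis using that by (simp add: G_def)
qed

lemma GL_det: "X \<in> GL d \<longleftrightarrow> X \<in> carrier_mat d d \<and> det X \<noteq> 0"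
proof
  assume "X \<in> GL d"
  then have X: "X \<in> carrier_mat d d" and "invertible_mat X" by (auto simp: GL_def)
  then obtain Y where Y: "X * Y = 1\<^sub>m d" "Y * X = 1\<^sub>m (dim_row Y)"
    by (auto simp: invertible_mat_def inverts_mat_def)
  have "dim_col (X * Y) = d" "dim_col (Y * X) = dim_row Y" unfolding Y by simp_all
  then have "Y \<in> carrier_mat d d" using X by auto
  then have "det X * det Y = 1" using det_mult[OF X, of Y] Y(1) by simp
  then show "X \<in> carrier_mat d d \<and> det X \<noteq> 0" using X by auto
next
  assume "X \<in> carrier_mat d d \<and> det X \<noteq> 0"
  then have X: "X \<in> carrier_mat d d" "det X \<noteq> 0" by auto
  then obtain Y where "Y \<in> carrier_mat d d" "Y * X = 1\<^sub>m d" "X * Y = 1\<^sub>m d"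
    using det_non_zero_imp_unit[OF X, of "()"] unfolding Units_def ring_mat_def by auto
  then have "invertible_mat X"
    using X(1) unfolding invertible_mat_def inverts_mat_def by auto
  then show "X \<in> GL d" using X by (simp add: GL_def)
qed

text \<open>
  The largest element of \<open>S\<close> is at least \<open>card S - 1\<close>; remove it and compare its factor with the last one
  of the initial segment.
\<close>

lemma prod_le_prod_initial:
  fixes a :: "nat \<Rightarrow> real"
  assumes "\<And>i. i < d \<Longrightarrow> 0 \<le> a i" "\<And>i j. i \<le> j \<Longrightarrow> j < d \<Longrightarrow> a j \<le> a i"
    and "card S = k" "S \<subseteq> {0..<d}"
  shows "prod a S \<le> (\<Prod>i = 0..<k. a i)"
  using assms(3,4)
proof (induction k arbitrary: S)
  case 0
  then have "S = {}" using finite_subset[of S "{0..<d}"] by simp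
  then show ?case by simp
next
  case (Suc k)
  have fin: "finite S" "S \<noteq> {}" using Suc.prems finite_subset[of S "{0..<d}"] by auto
  define m where "m = Max S"
  have m: "m \<in> S" using fin by (simp add: m_def)
  have "S \<subseteq> {0..m}" using fin by (auto simp: m_def)
  then have "Suc k \<le> Suc m" using card_mono[of "{0..m}" S] Suc.prems by simp
  then have "a m \<le> a k" using assms(2)[of k m] m Suc.prems by auto
  moreover have "prod a (S - {m}) \<le> (\<Prod>i = 0..<k. a i)"
    using Suc.prems m fin by (intro Suc.IH) auto
  moreover have "k < d" using card_mono[of "{0..<d}" S] Suc.prems by simp
  ultimately have "prod a (S - {m}) * a m \<le> (\<Prod>i = 0..<k. a i) * a k"
    using assms(1) m Suc.prems by (intro mult_mono) (auto intro!: prod_nonneg)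
  then show ?case using fin m by (simp add: prod.remove[of S m] mult.commute)
qed

text \<open>
  After triangularizing the Gram matrix, the sum of squared minors becomes \<open>fact k\<close> times the sum, over all
  injective selections of \<open>k\<close> eigenvalues, of their products. There are at most \<open>d ^ k\<close> selections, and
  the largest product is that of the \<open>k\<close> largest eigenvalues.
\<close>

lemma singular_values_minors:
  assumes X: "X \<in> carrier_mat d d" and k: "k \<le> d"
  shows "(\<Prod>i = 1..k. singular_value X i)\<^sup>2 \<le> minors_sq d k X"
    and "minors_sq d k X \<le> fact k * real d ^ k * (\<Prod>i = 1..k. singular_value X i)\<^sup>2"
    and "0 \<le> (\<Prod>i = 1..k. singular_value X i)"
proof -
  define G where "G = transpose_mat X * X"
  have G: "G \<in> carrier_mat d d" using X by (simp add: G_def)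
  obtain rs where rs: "length rs = d" "sorted (rev rs)" "\<And>r. r \<in> set rs \<Longrightarrow> 0 \<le> r"
    "char_poly G = (\<Prod>r\<leftarrow>rs. [:- r, 1:])"
    using char_poly_gram_factors[OF X] unfolding G_def by blast
  obtain T P Q where T: "schur_decomposition G rs = (T, P, Q)" by (cases "schur_decomposition G rs") auto
  note schur = schur_decomposition[OF G rs(4) T]
  have Tc: "T \<in> carrier_mat d d" using similar_mat_witD2[OF G] schur by blast
  have diag: "T $$ (i, i) = rs ! i" if "i < d" for i
  proof -
    have "diag_mat T ! i = T $$ (i, i)" using Tc that by (simp add: diag_mat_def)
    then show ?thesis using schur by simp
  qed
  have pos: "0 \<le> rs ! i" if "i < d" for i using rs that by auto
  have anti: "rs ! j \<le> rs ! i" if "i \<le> j" "j < d" for i j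
    using rs(1,2) that by (simp add: sorted_rev_nth_mono)
  have "proots (char_poly G) = mset rs"
  proof -
    have "proots (\<Prod>r\<leftarrow>rs. [:- r, 1:]) = (\<Sum>p\<leftarrow>map (\<lambda>r. [:- r, 1:]) rs. proots p)"
      by (subst proots_prod_list[symmetric]) auto
    also have "\<dots> = mset rs" by (induction rs) simp_all
    finally show ?thesis by (simp add: rs(4))
  qed
  then have "singular_values X = rev (sort (map sqrt rs))"
    by (simp add: singular_values_def flip: G_def mset_map)
  moreover have "sort (map sqrt rs) = rev (map sqrt rs)"
  proof (rule properties_for_sort)
    show "sorted (rev (map sqrt rs))"
      unfolding sorted_rev_iff_nth_mono using anti rs(1) by auto
  qed simp
  ultimately have sv: "singular_value X (Suc i) = sqrt (rs ! i)" if "i < d" for i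
    using that rs(1) by (simp add: singular_value_def)
  have reindex: "(\<Prod>i = 1..k. singular_value X i) = (\<Prod>i = 0..<k. sqrt (rs ! i))"
  proof -
    have "(\<Prod>i = 1..k. singular_value X i) = (\<Prod>i = 0..<k. singular_value X (Suc i))"
      using prod.shift_bounds_Suc_ivl[of "singular_value X" 0 k]
      by (simp add: atLeastLessThanSuc_atLeastAtMost)
    then show ?thesis using sv k by simp
  qed
  show "0 \<le> (\<Prod>i = 1..k. singular_value X i)"
    unfolding reindex using pos k by (intro prod_nonneg) auto
  have sq: "(\<Prod>i = 1..k. singular_value X i)\<^sup>2 = (\<Prod>i = 0..<k. rs ! i)"
    unfolding reindex prod_power_distrib using pos k by (intro prod.cong) auto
  define I where "I = {f \<in> index_tuples k d. inj_on f {0..<k}}"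
  have finI: "finite I" by (simp add: I_def)
  have "minors_sq d k X = fact k * (\<Sum>f\<in>I. \<Prod>i = 0..<k. rs ! f i)"
  proof -
    have "principal_minors d k G = principal_minors d k T"
      using principal_minors_similar[OF _ G] schur by blast
    also have "\<dots> = (\<Sum>f\<in>I. \<Prod>i = 0..<k. T $$ (f i, f i))"
      unfolding I_def using schur by (intro principal_minors_upper_triangular[OF Tc]) auto
    also have "\<dots> = (\<Sum>f\<in>I. \<Prod>i = 0..<k. rs ! f i)"
      using diag index_tuples_lt by (intro sum.cong prod.cong) (auto simp: I_def)
    finally show ?thesis using minors_sq_gram[OF X] by (simp add: G_def)
  qed
  note eq = this
  have nonneg: "0 \<le> (\<Prod>i = 0..<k. rs ! f i)" if "f \<in> I" for f
    using that index_tuples_lt pos by (intro prod_nonneg) (auto simp: I_def)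
  show "(\<Prod>i = 1..k. singular_value X i)\<^sup>2 \<le> minors_sq d k X"
  proof -
    \<comment> \<open>The selection of the first \<open>k\<close> eigenvalues, which are the largest since the list is decreasing.\<close>
    let ?f = "restrict (\<lambda>i. i) {0..<k}"
    have "?f \<in> I" using k by (auto simp: I_def index_tuples_def inj_on_def)
    then have "(\<Prod>i = 0..<k. rs ! ?f i) \<le> (\<Sum>f\<in>I. \<Prod>i = 0..<k. rs ! f i)"
      using nonneg finI by (intro member_le_sum[of ?f I "\<lambda>f. \<Prod>i = 0..<k. rs ! f i"]) blast+
    also have "\<dots> \<le> fact k * (\<Sum>f\<in>I. \<Prod>i = 0..<k. rs ! f i)"
      using mult_right_mono[OF fact_ge_1[of k, where ?'a = real] sum_nonneg[OF nonneg, of I]] by simp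
    finally show ?thesis unfolding sq eq by simp
  qed
  show "minors_sq d k X \<le> fact k * real d ^ k * (\<Prod>i = 1..k. singular_value X i)\<^sup>2"
  proof -
    have "(\<Prod>i = 0..<k. rs ! f i) \<le> (\<Prod>i = 0..<k. rs ! i)" if f: "f \<in> I" for f
    proof -
      have inj: "inj_on f {0..<k}" "f ` {0..<k} \<subseteq> {0..<d}"
        using f index_tuples_lt by (auto simp: I_def)
      have "(\<Prod>i = 0..<k. rs ! f i) = prod ((!) rs) (f ` {0..<k})"
        by (simp add: prod.reindex[OF inj(1)])
      also have "\<dots> \<le> (\<Prod>i = 0..<k. rs ! i)"
        using inj pos anti by (intro prod_le_prod_initial[of d]) (auto simp: card_image)
      finally show ?thesis .
    qed
    then have "(\<Sum>f\<in>I. \<Prod>i = 0..<k. rs ! f i) \<le> real (card I) * (\<Prod>i = 0..<k. rs ! i)"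
      by (rule sum_bounded_above)
    also have "\<dots> \<le> real d ^ k * (\<Prod>i = 0..<k. rs ! i)"
    proof (rule mult_right_mono)
      have "card I \<le> card (index_tuples k d)" by (rule card_mono) (auto simp: I_def)
      then show "real (card I) \<le> real d ^ k"
        by (simp add: index_tuples_def card_PiE flip: of_nat_power)
      show "0 \<le> (\<Prod>i = 0..<k. rs ! i)" using pos k by (intro prod_nonneg) auto
    qed
    finally show ?thesis unfolding sq eq by (simp add: mult.assoc)
  qed
qed

text \<open>
  The \<open>d\<close>-minors include the determinant, so by the comparison above the product of all singular
  values is nonzero.
\<close>

lemma singular_value_pos:
  assumes "X \<in> GL d" "1 \<le> i" "i \<le> d"
  shows "0 < singular_value X i"
proof -
  have X: "X \<in> carrier_mat d d" "det X \<noteq> 0" using assms by (auto simp: GL_det)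
  let ?f = "restrict (\<lambda>i. i) {0..<d}"
  have "mat d d (\<lambda>(i, j). X $$ (?f i, ?f j)) = X" using X by (intro eq_matI) auto
  then have "minor d X ?f ?f = det X" by (simp add: minor_def)
  moreover have f: "?f \<in> index_tuples d d" by (auto simp: index_tuples_def)
  ultimately have "(det X)\<^sup>2 \<le> (\<Sum>g\<in>index_tuples d d. (minor d X ?f g)\<^sup>2)"
    using member_le_sum[of ?f "index_tuples d d" "\<lambda>g. (minor d X ?f g)\<^sup>2"] by simp
  also have "\<dots> \<le> minors_sq d d X"
    unfolding minors_sq_def
    using f by (intro member_le_sum[of ?f "index_tuples d d" "\<lambda>f. \<Sum>g\<in>index_tuples d d. (minor d X f g)\<^sup>2"])
      (auto intro: sum_nonneg)
  finally have "(det X)\<^sup>2 \<le> fact d * real d ^ d * (\<Prod>i = 1..d. singular_value X i)\<^sup>2"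
    using singular_values_minors(2)[OF X(1), of d] by simp
  moreover have "0 < (det X)\<^sup>2" using X by simp
  ultimately have nz: "(\<Prod>i = 1..d. singular_value X i) \<noteq> 0"
    by (intro notI) (simp only: power_zero_numeral mult_zero_right)
  have pos: "0 < (\<Prod>i = 1..j. singular_value X i)" if "j \<le> d" for j
  proof -
    have "{1..j} \<subseteq> {1..d}" using that by auto
    then have "(\<Prod>i = 1..j. singular_value X i) \<noteq> 0"
      using nz by (meson finite_atLeastAtMost prod_zero_iff subsetD)
    then show ?thesis using singular_values_minors(3)[OF X(1) that] by linarith
  qed
  have "(\<Prod>i = 1..i. singular_value X i) = (\<Prod>i = 1..i - 1. singular_value X i) * singular_value X i"
    using assms(2) prod.nat_ivl_Suc'[of 1 "i - 1" "singular_value X"] by (simp add: mult.commute)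
  moreover have "0 < (\<Prod>i = 1..i - 1. singular_value X i)" using pos[of "i - 1"] assms(3) by linarith
  ultimately show ?thesis using pos[OF assms(3)] zero_less_mult_pos by metis
qed

section \<open>A submultiplicative substitute for the singular value function\<close>

text \<open>
  With \<open>P k\<close> the product of the \<open>k\<close> largest singular values, \<open>svf s X = P k powr (1 - t) * P (k + 1) powr t\<close> for
  invertible \<open>X\<close>. This is the logarithm of that expression with \<open>P\<close> replaced by the square root of \<open>minors_sq\<close>.
\<close>

definition log_minors :: "nat \<Rightarrow> real \<Rightarrow> real mat \<Rightarrow> real" where
  "log_minors d s X = (let k = nat \<lfloor>s\<rfloor>; t = s - real k in
     ((1 - t) * ln (minors_sq d k X) + t * ln (minors_sq d (Suc k) X)) / 2)"

lemma minors_sq_pos: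
  assumes "X \<in> GL d" "k \<le> d"
  shows "0 < minors_sq d k X"
proof -
  have "0 < (\<Prod>i = 1..k. singular_value X i)"
    using singular_value_pos[OF assms(1)] assms(2) by (intro prod_pos) auto
  then show ?thesis
    using singular_values_minors(1)[of X d k] assms by (simp add: GL_det) (smt (verit) zero_less_power)
qed

lemma floor_index_less: "0 \<le> s \<Longrightarrow> s < real d \<Longrightarrow> nat \<lfloor>s\<rfloor> < d"
  by (simp add: nat_less_iff floor_less_iff)

lemma svf_pos:
  assumes "X \<in> GL d" "0 \<le> s" "s < real d"
  shows "0 < svf s X"
proof -
  have "0 < (\<Prod>i = 1..nat \<lfloor>s\<rfloor>. singular_value X i)"
    using singular_value_pos[OF assms(1)] floor_index_less[OF assms(2,3)] by (intro prod_pos) auto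
  moreover have "0 < singular_value X (nat \<lfloor>s\<rfloor> + 1)"
    using singular_value_pos[OF assms(1)] floor_index_less[OF assms(2,3)] by simp
  ultimately show ?thesis by (simp add: svf_def Let_def)
qed

lemma ln_svf_log_minors:
  assumes "0 \<le> s" "s < real d"
  obtains K where "\<And>X. X \<in> GL d \<Longrightarrow> \<bar>ln (svf s X) - log_minors d s X\<bar> \<le> K"
proof -
  define k where "k = nat \<lfloor>s\<rfloor>"
  define t where "t = s - real k"
  have k: "k < d" using floor_index_less[OF assms] by (simp add: k_def)
  have t: "0 \<le> t" "t \<le> 1" using assms(1) unfolding t_def k_def by linarith+
  \<comment> \<open>The logarithm of the comparison factor for \<open>j\<close>-minors; it is nonnegative because \<open>d\<close> is positive.\<close>
  define c where "c j = ln (fact j * real d ^ j)" for j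
  have one: "1 \<le> fact j * real d ^ j" for j
    using k mult_mono[of 1 "fact j" 1 "real d ^ j"] by (simp add: one_le_power)
  have c: "0 \<le> c j" for j unfolding c_def using one by simp
  have "\<bar>ln (svf s X) - log_minors d s X\<bar> \<le> c k + c (Suc k)" if X: "X \<in> GL d" for X
  proof -
    define P where "P j = (\<Prod>i = 1..j. singular_value X i)" for j
    have Ppos: "0 < P j" if "j \<le> d" for j
      unfolding P_def using singular_value_pos[OF X] that by (intro prod_pos) auto
    have close: "\<bar>ln (minors_sq d j X) / 2 - ln (P j)\<bar> \<le> c j" if j: "j \<le> d" for j
    proof -
      have bnd: "(P j)\<^sup>2 \<le> minors_sq d j X" "minors_sq d j X \<le> fact j * real d ^ j * (P j)\<^sup>2"
        using singular_values_minors(1,2)[of X d j] X j by (auto simp: P_def GL_det)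
      have pos: "0 < (P j)\<^sup>2" using Ppos[OF j] by simp
      have "2 * ln (P j) \<le> ln (minors_sq d j X)"
        using bnd(1) pos less_le_trans[OF pos bnd(1)] ln_realpow[of "P j" 2] ln_le_cancel_iff[of "(P j)\<^sup>2" "minors_sq d j X"]
        by simp
      moreover have "ln (minors_sq d j X) \<le> c j + 2 * ln (P j)"
      proof -
        have "ln (minors_sq d j X) \<le> ln (fact j * real d ^ j * (P j)\<^sup>2)"
          using bnd less_le_trans[OF pos bnd(1)] by (subst ln_le_cancel_iff) linarith+
        also have "\<dots> = c j + ln ((P j)\<^sup>2)"
          unfolding c_def using one[of j] pos by (intro ln_mult_pos) linarith+
        finally show ?thesis using Ppos[OF j] by (simp add: ln_realpow)
      qed
      ultimately show ?thesis using c[of j] by (auto simp: abs_le_iff)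
    qed
    have sv: "0 < singular_value X (Suc k)" using singular_value_pos[OF X] k by simp
    have "ln (P (Suc k)) = ln (P k) + ln (singular_value X (Suc k))"
      using ln_mult_pos[OF Ppos[of k] sv] k by (simp add: P_def)
    moreover have "ln (svf s X) = ln (P k) + t * ln (singular_value X (Suc k))"
    proof -
      have "svf s X = P k * singular_value X (Suc k) powr t"
        by (simp add: svf_def Let_def P_def k_def t_def)
      then show ?thesis
        using ln_mult_pos[OF Ppos[of k], of "singular_value X (Suc k) powr t"] sv k by (simp add: ln_powr)
    qed
    ultimately have "ln (svf s X) = (1 - t) * ln (P k) + t * ln (P (Suc k))"
      by (simp add: algebra_simps)
    then have "ln (svf s X) - log_minors d s X =
        (1 - t) * (ln (P k) - ln (minors_sq d k X) / 2) +
        t * (ln (P (Suc k)) - ln (minors_sq d (Suc k) X) / 2)"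
      unfolding log_minors_def Let_def k_def[symmetric] t_def[symmetric]
      by (simp add: algebra_simps add_divide_distrib diff_divide_distrib)
    also have "\<bar>\<dots>\<bar> \<le> 1 * c k + 1 * c (Suc k)"
      using t close[of k] close[of "Suc k"] k
      by (intro order_trans[OF abs_triangle_ineq] add_mono; unfold abs_mult)
        (intro mult_mono; auto simp: abs_minus_commute)+
    finally show ?thesis by simp
  qed
  then show ?thesis using that by blast
qed

lemma log_minors_mono:
  assumes "0 \<le> s" "c > 0"
    and "\<And>k. k \<in> {nat \<lfloor>s\<rfloor>, Suc (nat \<lfloor>s\<rfloor>)} \<Longrightarrow> 0 < minors_sq d k X \<and> minors_sq d k X \<le> c * minors_sq d k Y"
  shows "log_minors d s X \<le> ln c / 2 + log_minors d s Y"
proof -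
  define k where "k = nat \<lfloor>s\<rfloor>"
  define t where "t = s - real k"
  have t: "0 \<le> t" "t \<le> 1" using assms(1) unfolding t_def k_def by linarith+
  have *: "ln (minors_sq d j X) \<le> ln c + ln (minors_sq d j Y)" if "j \<in> {k, Suc k}" for j
  proof -
    have j: "0 < minors_sq d j X" "minors_sq d j X \<le> c * minors_sq d j Y"
      using assms(3)[of j] that by (auto simp: k_def)
    then have "0 < minors_sq d j Y" using assms(2) by (metis less_le_trans zero_less_mult_pos)
    then show ?thesis
      using j assms(2) ln_mult[of c "minors_sq d j Y"] ln_le_cancel_iff[of "minors_sq d j X" "c * minors_sq d j Y"]
      by simp
  qed
  have "(1 - t) * ln (minors_sq d k X) + t * ln (minors_sq d (Suc k) X)
     \<le> (1 - t) * (ln c + ln (minors_sq d k Y)) + t * (ln c + ln (minors_sq d (Suc k) Y))"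
    using t * by (intro add_mono mult_left_mono) auto
  then show ?thesis
    unfolding log_minors_def Let_def k_def[symmetric] t_def[symmetric]
    by (simp add: algebra_simps add_divide_distrib diff_divide_distrib)
qed

lemma log_minors_mult:
  assumes "0 \<le> s" and X: "X \<in> carrier_mat d d" and Y: "Y \<in> carrier_mat d d"
    and pos: "\<And>k. k \<in> {nat \<lfloor>s\<rfloor>, Suc (nat \<lfloor>s\<rfloor>)} \<Longrightarrow> 0 < minors_sq d k (X * Y)"
  shows "log_minors d s (X * Y) \<le> log_minors d s X + log_minors d s Y"
proof -
  define k where "k = nat \<lfloor>s\<rfloor>"
  define t where "t = s - real k"
  have t: "0 \<le> t" "t \<le> 1" using assms(1) unfolding t_def k_def by linarith+
  have *: "ln (minors_sq d j (X * Y)) \<le> ln (minors_sq d j X) + ln (minors_sq d j Y)"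
    if "j \<in> {k, Suc k}" for j
  proof -
    have j: "0 < minors_sq d j (X * Y)" "minors_sq d j (X * Y) \<le> minors_sq d j X * minors_sq d j Y"
      using pos[of j] that minors_sq_mult[OF X Y] by (auto simp: k_def)
    then have "0 < minors_sq d j X * minors_sq d j Y" by linarith
    then have XY: "0 < minors_sq d j X" "0 < minors_sq d j Y"
      using minors_sq_nonneg[of d j X] minors_sq_nonneg[of d j Y] by (auto simp: zero_less_mult_iff)
    then show ?thesis
      using j ln_mult_pos[OF XY] ln_le_cancel_iff[of "minors_sq d j (X * Y)" "minors_sq d j X * minors_sq d j Y"]
      by simp
  qed
  have "(1 - t) * ln (minors_sq d k (X * Y)) + t * ln (minors_sq d (Suc k) (X * Y))
     \<le> (1 - t) * (ln (minors_sq d k X) + ln (minors_sq d k Y)) +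
       t * (ln (minors_sq d (Suc k) X) + ln (minors_sq d (Suc k) Y))"
    using t * by (intro add_mono mult_left_mono) auto
  then show ?thesis
    unfolding log_minors_def Let_def k_def[symmetric] t_def[symmetric]
    by (simp add: algebra_simps add_divide_distrib diff_divide_distrib)
qed

section \<open>Growth rates of subadditive sequences\<close>

lemma tendsto_div_nat_cong:
  fixes x y :: "nat \<Rightarrow> real"
  assumes "\<And>n. \<bar>x n - y n\<bar> \<le> K"
  shows "(\<lambda>n. x n / real n) \<longlonglongrightarrow> L \<longleftrightarrow> (\<lambda>n. y n / real n) \<longlonglongrightarrow> L"
proof -
  have "(\<lambda>n. x n / real n - y n / real n) \<longlonglongrightarrow> 0"
  proof (rule tendsto_rabs_zero_cancel, rule tendsto_sandwich[OF _ _ tendsto_const])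
    show "\<forall>\<^sub>F n in sequentially. \<bar>x n / real n - y n / real n\<bar> \<le> K / real n"
      using assms by (intro always_eventually) (auto simp flip: diff_divide_distrib intro: divide_right_mono)
    show "(\<lambda>n. K / real n) \<longlonglongrightarrow> 0" by (rule lim_const_over_n)
  qed simp
  then show ?thesis by (rule Lim_transform_eq)
qed

definition subadditive_seq :: "(nat \<Rightarrow> real) \<Rightarrow> bool" where
  "subadditive_seq v \<longleftrightarrow> (\<forall>m n. v (m + n) \<le> v m + v n)"

lemma subadditive_mult_add:
  assumes "subadditive_seq v"
  shows "v (q * n + r) \<le> real q * v n + v r"
proof (induction q)
  case (Suc q)
  have "v (Suc q * n + r) \<le> v n + v (q * n + r)"
    using assms[unfolded subadditive_seq_def, rule_format, of n "q * n + r"] by (simp add: add.assoc)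
  with Suc show ?case by (simp add: algebra_simps)
qed simp

text \<open>
  The half of Fekete's lemma that does not involve an infimum: divide \<open>m\<close> by \<open>n\<close> with remainder. The
  remainder and the bounded distance between \<open>u\<close> and \<open>v\<close> vanish after division by \<open>m\<close>.
\<close>

lemma eventually_div_le_of_subadditive:
  assumes v: "subadditive_seq v" and le: "\<And>m. u m \<le> v m + C" and n: "0 < n" and e: "0 < e"
  shows "\<forall>\<^sub>F m in sequentially. u m / real m \<le> v n / real n + e"
proof -
  \<comment> \<open>The remainder of the division of \<open>m\<close> by \<open>n\<close> takes finitely many values.\<close>
  define M where "M = Max ((\<lambda>r. \<bar>v r\<bar>) ` {..<n})"
  have "(\<lambda>m. (\<bar>v n\<bar> + M + C) / real m) \<longlonglongrightarrow> 0" by (rule lim_const_over_n)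
  then have "\<forall>\<^sub>F m in sequentially. (\<bar>v n\<bar> + M + C) / real m < e" by (rule order_tendstoD) (rule e)
  then show ?thesis using eventually_gt_at_top[of 0]
  proof eventually_elim
    case (elim m)
    define q where "q = m div n"
    define r where "r = m mod n"
    have m: "m = q * n + r" by (simp add: q_def r_def)
    have r: "r < n" using n by (simp add: r_def)
    have "\<bar>v r\<bar> \<le> M" unfolding M_def using r by (intro Max_ge) auto
    moreover have "real q * v n \<le> real m * (v n / real n) + \<bar>v n\<bar>"
    proof -
      have "real q * v n = real m * (v n / real n) - real r / real n * v n"
        using n by (simp add: m field_simps)
      moreover have "\<bar>real r / real n * v n\<bar> \<le> 1 * \<bar>v n\<bar>"
        unfolding abs_mult using r by (intro mult_right_mono) auto
      ultimately show ?thesis by linarith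
    qed
    ultimately have "u m \<le> real m * (v n / real n) + (\<bar>v n\<bar> + M + C)"
      using le[of m] subadditive_mult_add[OF v, of q n r] by (simp flip: m)
    then have "u m / real m \<le> v n / real n + (\<bar>v n\<bar> + M + C) / real m"
      using elim by (simp add: field_simps)
    with elim show ?case by linarith
  qed
qed

text \<open>
  If \<open>u'\<close> is growing at rate \<open>L\<close>, choose \<open>n\<close> with \<open>u' n / n\<close> close to \<open>L\<close>; the sequence \<open>v\<close> given by \<open>up\<close>
  bounds the growth of \<open>u\<close> by nearly \<open>v n / n\<close>, hence by nearly \<open>L\<close>. Conversely, a growth rate \<open>L\<close> of \<open>u\<close> is
  bounded by every \<open>u' n / n\<close> by the same argument. The constant \<open>C\<close> may depend on \<open>n\<close> and \<open>e\<close>.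
\<close>

lemma subadditive_squeeze:
  fixes u u' :: "nat \<Rightarrow> real"
  assumes low: "\<And>n. u' n \<le> u n"
    and up: "\<And>n e. 0 < e \<Longrightarrow> \<exists>v C. subadditive_seq v \<and> v n \<le> u' n + e \<and> (\<forall>m. u m \<le> v m + C)"
  shows "(\<lambda>n. u n / real n) \<longlonglongrightarrow> L \<longleftrightarrow> (\<lambda>n. u' n / real n) \<longlonglongrightarrow> L"
proof -
  have low': "u' n / real n \<le> u n / real n" for n
    using low by (simp add: divide_right_mono)
  have ev: "\<forall>\<^sub>F m in sequentially. u m / real m \<le> u' n / real n + e" if "0 < e" "0 < n" for n e
  proof -
    have e2: "0 < e / 2" using that by simp
    obtain v C where v: "subadditive_seq v" "v n \<le> u' n + e / 2" "\<And>m. u m \<le> v m + C"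
      using up[OF e2, of n] by blast
    have "v n / real n \<le> u' n / real n + e / 2"
    proof -
      have "v n / real n \<le> (u' n + e / 2) / real n" using v(2) by (simp add: divide_right_mono)
      moreover have "e / 2 / real n \<le> e / 2" using that by (simp add: divide_le_eq)
      ultimately show ?thesis by (simp add: add_divide_distrib)
    qed
    moreover have "\<forall>\<^sub>F m in sequentially. u m / real m \<le> v n / real n + e / 2"
      using eventually_div_le_of_subadditive[OF v(1,3), of n "e / 2"] that by simp
    ultimately show ?thesis by (auto elim: eventually_mono)
  qed
  show ?thesis
  proof
    assume L: "(\<lambda>n. u n / real n) \<longlonglongrightarrow> L"
    have ge: "L \<le> u' n / real n" if "0 < n" for n
    proof (rule field_le_epsilon)
      fix e :: real assume "0 < e"
      then show "L \<le> u' n / real n + e"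
        using ev[OF _ that] tendsto_upperbound[OF L] by simp
    qed
    show "(\<lambda>n. u' n / real n) \<longlonglongrightarrow> L"
      by (rule tendsto_sandwich[OF _ _ tendsto_const L])
        (use ge low' in \<open>auto intro: eventually_mono[OF eventually_gt_at_top[of 0]]\<close>)
  next
    assume L: "(\<lambda>n. u' n / real n) \<longlonglongrightarrow> L"
    show "(\<lambda>n. u n / real n) \<longlonglongrightarrow> L"
    proof (rule order_tendstoI)
      fix a assume "a < L"
      then have "\<forall>\<^sub>F n in sequentially. a < u' n / real n" by (rule order_tendstoD[OF L])
      then show "\<forall>\<^sub>F n in sequentially. a < u n / real n"
        using low' by (auto elim!: eventually_mono intro: less_le_trans)
    next
      fix a assume a: "L < a"
      have "\<forall>\<^sub>F n in sequentially. u' n / real n < (L + a) / 2"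
        using a by (intro order_tendstoD[OF L]) simp
      then have "\<forall>\<^sub>F n in sequentially. u' n / real n < (L + a) / 2 \<and> 0 < n"
        using eventually_gt_at_top[of 0] by (rule eventually_conj)
      then obtain n where n: "u' n / real n < (L + a) / 2" "0 < n"
        by (auto simp: eventually_sequentially)
      have "\<forall>\<^sub>F m in sequentially. u m / real m \<le> u' n / real n + (a - L) / 2"
        using a n by (intro ev) auto
      moreover have "u' n / real n + (a - L) / 2 < a" using n by (simp add: field_simps)
      ultimately show "\<forall>\<^sub>F m in sequentially. u m / real m < a"
        by (auto elim!: eventually_mono)
    qed
  qed
qed

section \<open>Averages over words\<close>

lemma words_0: "words N 0 = {[]}"
  by (auto simp: words_def)

lemma finite_words [simp]: "finite (words N n)"
proof -
  have "words N n = {w. set w \<subseteq> {1..N} \<and> length w = n}" by (auto simp: words_def)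
  then show ?thesis by (simp add: finite_lists_length_eq)
qed

lemma words_nonempty: "1 \<le> N \<Longrightarrow> words N n \<noteq> {}"
proof -
  assume "1 \<le> N"
  then have "replicate n 1 \<in> words N n" by (auto simp: words_def)
  then show ?thesis by blast
qed

lemma sum_words_append:
  "(\<Sum>w\<in>words N (m + n). f w) = (\<Sum>u\<in>words N m. \<Sum>v\<in>words N n. f (u @ v))"
proof -
  have "bij_betw (\<lambda>(u, v). u @ v) (words N m \<times> words N n) (words N (m + n))"
  proof (rule bij_betwI[where g = "\<lambda>w. (take m w, drop m w)"])
    show "(\<lambda>w. (take m w, drop m w)) \<in> words N (m + n) \<rightarrow> words N m \<times> words N n"
      by (auto simp: words_def dest: in_set_takeD in_set_dropD)
  qed (auto simp: words_def subset_iff)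
  then have "(\<Sum>w\<in>words N (m + n). f w) = (\<Sum>p\<in>words N m \<times> words N n. f (case p of (u, v) \<Rightarrow> u @ v))"
    by (rule sum.reindex_bij_betw[symmetric])
  then show ?thesis by (simp add: sum.cartesian_product case_prod_beta)
qed

definition all_words :: "nat \<Rightarrow> nat list set" where
  "all_words N = lists {1..N}"

lemma words_all_words: "w \<in> words N n \<Longrightarrow> w \<in> all_words N"
  by (auto simp: words_def all_words_def)

definition subadditive_potential :: "nat \<Rightarrow> (nat list \<Rightarrow> real) \<Rightarrow> bool" where
  "subadditive_potential N a \<longleftrightarrow> (\<forall>u\<in>all_words N. \<forall>v\<in>all_words N. a (u @ v) \<le> a u + a v)"

text \<open>
  What the logarithmic partition function and the integral against an invariant measure have in common;
  it lets the pressure and the Lyapunov exponent be treated at once.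
\<close>

definition averaging :: "nat \<Rightarrow> (nat \<Rightarrow> (nat list \<Rightarrow> real) \<Rightarrow> real) \<Rightarrow> bool" where
  "averaging N F \<longleftrightarrow>
     (\<forall>n a b c. (\<forall>w\<in>words N n. a w \<le> b w + c) \<longrightarrow> F n a \<le> F n b + c) \<and>
     (\<forall>a. subadditive_potential N a \<longrightarrow> subadditive_seq (\<lambda>n. F n a))"

lemma averaging_mono:
  "averaging N F \<Longrightarrow> (\<And>w. w \<in> words N n \<Longrightarrow> a w \<le> b w + c) \<Longrightarrow> F n a \<le> F n b + c"
  by (simp add: averaging_def)

lemma averaging_growth_eq:
  assumes F: "averaging N F"
    and low: "\<And>w. w \<in> all_words N \<Longrightarrow> a' w \<le> a w"
    and up: "\<And>n e. 0 < e \<Longrightarrow> \<exists>b C. subadditive_potential N b \<and>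
      (\<forall>w\<in>words N n. b w \<le> a' w + e) \<and> (\<forall>w\<in>all_words N. a w \<le> b w + C)"
  shows "(\<lambda>n. F n a / real n) \<longlonglongrightarrow> L \<longleftrightarrow> (\<lambda>n. F n a' / real n) \<longlonglongrightarrow> L"
proof (rule subadditive_squeeze)
  show "F n a' \<le> F n a" for n
    using averaging_mono[OF F, of n a' a 0] low words_all_words by simp
  show "\<exists>v C. subadditive_seq v \<and> v n \<le> F n a' + e \<and> (\<forall>m. F m a \<le> v m + C)" if e: "0 < e" for n e
  proof -
    obtain b C where b: "subadditive_potential N b" "\<And>w. w \<in> words N n \<Longrightarrow> b w \<le> a' w + e"
      "\<And>w. w \<in> all_words N \<Longrightarrow> a w \<le> b w + C"
      using up[OF e, of n] by blast
    have "subadditive_seq (\<lambda>m. F m b)" using F b(1) by (simp add: averaging_def)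
    moreover have "F n b \<le> F n a' + e" using averaging_mono[OF F] b(2) by blast
    moreover have "F m a \<le> F m b + C" for m
      using averaging_mono[OF F] b(3) words_all_words by blast
    ultimately show ?thesis by blast
  qed
qed

lemma averaging_log_partition:
  assumes "1 \<le> N"
  shows "averaging N (\<lambda>n a. ln (\<Sum>w\<in>words N n. exp (a w)))"
proof -
  have pos: "0 < (\<Sum>w\<in>words N n. exp (a w))" for n and a :: "nat list \<Rightarrow> real"
    using words_nonempty[OF assms] by (intro sum_pos) auto
  have "ln (\<Sum>w\<in>words N n. exp (a w)) \<le> ln (\<Sum>w\<in>words N n. exp (b w)) + c"
    if "\<forall>w\<in>words N n. a w \<le> b w + c" for n c and a b :: "nat list \<Rightarrow> real"
  proof -
    have "(\<Sum>w\<in>words N n. exp (a w)) \<le> (\<Sum>w\<in>words N n. exp (b w)) * exp c"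
      unfolding sum_distrib_right exp_add[symmetric] using that by (intro sum_mono) simp
    then have "ln (\<Sum>w\<in>words N n. exp (a w)) \<le> ln ((\<Sum>w\<in>words N n. exp (b w)) * exp c)"
      using pos by (subst ln_le_cancel_iff) auto
    then show ?thesis using pos[of b n] by (simp add: ln_mult)
  qed
  moreover have "ln (\<Sum>w\<in>words N (m + n). exp (a w)) \<le>
      ln (\<Sum>w\<in>words N m. exp (a w)) + ln (\<Sum>w\<in>words N n. exp (a w))"
    if a: "subadditive_potential N a" for m n a
  proof -
    have "(\<Sum>w\<in>words N (m + n). exp (a w)) \<le> (\<Sum>u\<in>words N m. \<Sum>v\<in>words N n. exp (a u) * exp (a v))"
      unfolding sum_words_append exp_add[symmetric]
      using a words_all_words by (intro sum_mono) (simp add: subadditive_potential_def)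
    also have "\<dots> = (\<Sum>w\<in>words N m. exp (a w)) * (\<Sum>w\<in>words N n. exp (a w))"
      by (simp add: sum_product)
    finally have "ln (\<Sum>w\<in>words N (m + n). exp (a w)) \<le>
        ln ((\<Sum>w\<in>words N m. exp (a w)) * (\<Sum>w\<in>words N n. exp (a w)))"
      using pos by (subst ln_le_cancel_iff) auto
    then show ?thesis using pos[of a] by (simp add: ln_mult_pos)
  qed
  ultimately show ?thesis by (auto simp: averaging_def subadditive_seq_def)
qed

lemma seqs_eq: "seqs N = UNIV \<rightarrow>\<^sub>E {1..N}"
  by (simp add: seqs_def seq_topology_def)

lemma space_seq_borel: "space (seq_borel N) = seqs N"
  unfolding seq_borel_def by (rule space_measure_of) (auto simp: seqs_def dest: openin_subset)

lemma cylinder_in_seq_borel: "cylinder N w \<in> sets (seq_borel N)"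
proof -
  define K where "K k = (if k < length w then {w ! k} \<inter> {1..N} else {1..N})" for k
  have "cylinder N w = (\<Pi>\<^sub>E k\<in>UNIV. K k)"
    unfolding cylinder_def seqs_eq K_def by (auto simp: PiE_iff split: if_splits) (metis atLeastAtMost_iff)+
  moreover have "openin (seq_topology N) (\<Pi>\<^sub>E k\<in>UNIV. K k)"
    unfolding seq_topology_def
  proof (rule product_topology_basis)
    have "{k. K k \<noteq> topspace (discrete_topology {1..N})} \<subseteq> {..<length w}" by (auto simp: K_def)
    then show "finite {k. K k \<noteq> topspace (discrete_topology {1..N})}" by (rule finite_subset) simp
  qed (auto simp: K_def)
  ultimately show ?thesis
    unfolding seq_borel_def by (subst sets_measure_of) (auto simp: seqs_def dest: openin_subset)
qed

context
  fixes N :: nat and \<mu> :: "(nat \<Rightarrow> nat) measure"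
  assumes mu: "\<mu> \<in> invariant_measures N"
begin

lemma invariant_prob_space: "prob_space \<mu>"
  using mu by (simp add: invariant_measures_def)

lemma invariant_space: "space \<mu> = seqs N"
  using mu sets_eq_imp_space_eq[of \<mu> "seq_borel N"] by (simp add: invariant_measures_def space_seq_borel)

lemma cylinder_sets: "cylinder N w \<in> sets \<mu>"
  using mu cylinder_in_seq_borel by (simp add: invariant_measures_def)

lemma sum_cylinder_suffix:
  "(\<Sum>v\<in>words N n. measure \<mu> (cylinder N (u @ v))) = measure \<mu> (cylinder N u)"
proof -
  interpret prob_space \<mu> by (rule invariant_prob_space)
  have "cylinder N u = (\<Union>v\<in>words N n. cylinder N (u @ v))"
  proof
    show "cylinder N u \<subseteq> (\<Union>v\<in>words N n. cylinder N (u @ v))"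
    proof
      fix x assume x: "x \<in> cylinder N u"
      define v where "v = map (\<lambda>i. x (length u + i)) [0..<n]"
      have "v \<in> words N n" using x by (auto simp: v_def words_def cylinder_def seqs_eq)
      moreover have "x \<in> cylinder N (u @ v)"
        using x by (auto simp: cylinder_def v_def nth_append)
      ultimately show "x \<in> (\<Union>v\<in>words N n. cylinder N (u @ v))" by blast
    qed
    show "(\<Union>v\<in>words N n. cylinder N (u @ v)) \<subseteq> cylinder N u"
      by (auto simp: cylinder_def nth_append)
  qed
  moreover have "disjoint_family_on (\<lambda>v. cylinder N (u @ v)) (words N n)"
  proof (unfold disjoint_family_on_def, intro ballI impI)
    fix v v' assume v: "v \<in> words N n" "v' \<in> words N n" "v \<noteq> v'"
    then obtain i where i: "i < n" "v ! i \<noteq> v' ! i"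
      using nth_equalityI[of v v'] by (auto simp: words_def)
    have "x (length u + i) = y ! i" if "x \<in> cylinder N (u @ y)" "y \<in> words N n" for x y
      using that i(1) by (auto simp: cylinder_def words_def nth_append)
    then show "cylinder N (u @ v) \<inter> cylinder N (u @ v') = {}"
      using i v by fastforce
  qed
  ultimately show ?thesis
    using finite_measure_finite_Union[of "words N n" "\<lambda>v. cylinder N (u @ v)"] cylinder_sets
    by (simp add: image_subset_iff)
qed

lemma sum_cylinder_first: "(\<Sum>i\<in>{1..N}. measure \<mu> (cylinder N (i # w))) = measure \<mu> (cylinder N w)"
proof -
  interpret prob_space \<mu> by (rule invariant_prob_space)
  have shift: "left_shift \<in> measurable \<mu> \<mu>" "distr \<mu> \<mu> left_shift = \<mu>"
    using mu by (auto simp: invariant_measures_def)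
  have mem: "x \<in> cylinder N (i # w) \<longleftrightarrow> x \<in> seqs N \<and> x 0 = i \<and> left_shift x \<in> cylinder N w" for x i
    by (auto simp: cylinder_def left_shift_def seqs_eq PiE_iff nth_Cons split: nat.splits)
  have "(\<Union>i\<in>{1..N}. cylinder N (i # w)) = left_shift -` cylinder N w \<inter> space \<mu>"
    by (auto simp: mem invariant_space) (auto simp: seqs_eq)
  moreover have "disjoint_family_on (\<lambda>i. cylinder N (i # w)) {1..N}"
    by (auto simp: disjoint_family_on_def mem)
  ultimately have "(\<Sum>i\<in>{1..N}. measure \<mu> (cylinder N (i # w))) = measure \<mu> (left_shift -` cylinder N w \<inter> space \<mu>)"
    using finite_measure_finite_Union[of "{1..N}" "\<lambda>i. cylinder N (i # w)"] cylinder_sets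
    by (simp add: image_subset_iff)
  also have "\<dots> = measure (distr \<mu> \<mu> left_shift) (cylinder N w)"
    by (rule measure_distr[symmetric, OF shift(1) cylinder_sets])
  finally show ?thesis by (simp add: shift(2))
qed

lemma sum_cylinder_prefix:
  "(\<Sum>u\<in>words N m. measure \<mu> (cylinder N (u @ v))) = measure \<mu> (cylinder N v)"
proof (induction m)
  case (Suc m)
  have w1: "words N 1 = (\<lambda>i. [i]) ` {1..N}"
    by (auto simp: words_def length_Suc_conv)
  have "(\<Sum>u\<in>words N (1 + m). measure \<mu> (cylinder N (u @ v))) =
      (\<Sum>u\<in>words N m. \<Sum>i\<in>{1..N}. measure \<mu> (cylinder N (i # u @ v)))"
    unfolding sum_words_append w1
    by (subst sum.swap) (simp add: sum.reindex inj_on_def)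
  then show ?case unfolding sum_cylinder_first Suc by simp
qed (simp add: words_0)

lemma sum_cylinder: "(\<Sum>w\<in>words N n. measure \<mu> (cylinder N w)) = 1"
proof -
  have "cylinder N [] = space \<mu>" by (simp add: cylinder_def invariant_space)
  then show ?thesis
    using sum_cylinder_suffix[of "[]" n] prob_space.prob_space[OF invariant_prob_space] by simp
qed

text \<open>
  Subadditivity is where invariance of the measure enters: the cylinders \<open>cylinder N (u @ v)\<close> sum
  to the measure of \<open>cylinder N v\<close> when \<open>u\<close> runs through all words of a fixed length.
\<close>

lemma averaging_integral: "averaging N (\<lambda>n a. \<Sum>w\<in>words N n. measure \<mu> (cylinder N w) * a w)"
proof -
  have "(\<Sum>w\<in>words N n. measure \<mu> (cylinder N w) * a w) \<le>
      (\<Sum>w\<in>words N n. measure \<mu> (cylinder N w) * b w) + c"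
    if "\<forall>w\<in>words N n. a w \<le> b w + c" for n a b c
  proof -
    have "(\<Sum>w\<in>words N n. measure \<mu> (cylinder N w) * a w) \<le>
        (\<Sum>w\<in>words N n. measure \<mu> (cylinder N w) * (b w + c))"
      using that by (intro sum_mono mult_left_mono) auto
    also have "\<dots> = (\<Sum>w\<in>words N n. measure \<mu> (cylinder N w) * b w) + c"
      using sum_cylinder[of n] by (simp add: distrib_left sum.distrib flip: sum_distrib_right)
    finally show ?thesis .
  qed
  moreover have "(\<Sum>w\<in>words N (m + n). measure \<mu> (cylinder N w) * a w) \<le>
      (\<Sum>w\<in>words N m. measure \<mu> (cylinder N w) * a w) + (\<Sum>w\<in>words N n. measure \<mu> (cylinder N w) * a w)"
    if a: "subadditive_potential N a" for m n a
  proof -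
    let ?p = "\<lambda>w. measure \<mu> (cylinder N w)"
    have "(\<Sum>w\<in>words N (m + n). ?p w * a w) \<le>
        (\<Sum>u\<in>words N m. \<Sum>v\<in>words N n. ?p (u @ v) * (a u + a v))"
      unfolding sum_words_append
      using a words_all_words by (intro sum_mono mult_left_mono) (auto simp: subadditive_potential_def)
    also have "\<dots> = (\<Sum>u\<in>words N m. \<Sum>v\<in>words N n. ?p (u @ v) * a u) +
        (\<Sum>v\<in>words N n. \<Sum>u\<in>words N m. ?p (u @ v) * a v)"
      by (subst (2) sum.swap) (simp add: distrib_left sum.distrib)
    also have "\<dots> = (\<Sum>u\<in>words N m. ?p u * a u) + (\<Sum>v\<in>words N n. ?p v * a v)"
      by (simp add: sum_cylinder_suffix sum_cylinder_prefix flip: sum_distrib_right)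
    finally show ?thesis .
  qed
  ultimately show ?thesis by (auto simp: averaging_def subadditive_seq_def)
qed

end

section \<open>Block triangular matrices and their diagonal parts\<close>

text \<open>
  Here \<open>b\<close> assigns to each row or column the number of its block. Only the order of these numbers matters, so
  no sizes or offsets of blocks enter, and the relation is visibly compatible with products.
\<close>

definition diagonal_part :: "(nat \<Rightarrow> nat) \<Rightarrow> nat \<Rightarrow> real mat \<Rightarrow> real mat \<Rightarrow> bool" where
  "diagonal_part b d X Y \<longleftrightarrow> X \<in> carrier_mat d d \<and> Y \<in> carrier_mat d d \<and>
     (\<forall>r<d. \<forall>c<d. b c < b r \<longrightarrow> X $$ (r, c) = 0) \<and>
     (\<forall>r<d. \<forall>c<d. Y $$ (r, c) = (if b r = b c then X $$ (r, c) else 0))"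

lemma diagonal_part_one: "diagonal_part b d (1\<^sub>m d) (1\<^sub>m d)"
  by (auto simp: diagonal_part_def)

lemma diagonal_part_mult:
  assumes X: "diagonal_part b d X X'" and Y: "diagonal_part b d Y Y'"
  shows "diagonal_part b d (X * Y) (X' * Y')"
proof -
  note X' = X[unfolded diagonal_part_def] and Y' = Y[unfolded diagonal_part_def]
  have entry: "(X * Y) $$ (r, c) = (\<Sum>m = 0..<d. X $$ (r, m) * Y $$ (m, c))"
    "(X' * Y') $$ (r, c) = (\<Sum>m = 0..<d. X' $$ (r, m) * Y' $$ (m, c))" if "r < d" "c < d" for r c
    using X' Y' that by (auto simp: scalar_prod_def)
  have zero: "(\<Sum>m = 0..<d. X $$ (r, m) * Y $$ (m, c)) = 0" if "r < d" "c < d" "b c < b r" for r c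
  proof (rule sum.neutral, intro ballI)
    fix m assume "m \<in> {0..<d}"
    then show "X $$ (r, m) * Y $$ (m, c) = 0"
      using X' Y' that by (cases "b m < b r") auto
  qed
  have diag: "(\<Sum>m = 0..<d. X' $$ (r, m) * Y' $$ (m, c)) =
      (if b r = b c then \<Sum>m = 0..<d. X $$ (r, m) * Y $$ (m, c) else 0)" if rc: "r < d" "c < d" for r c
  proof (cases "b r = b c")
    case True
    have "X' $$ (r, m) * Y' $$ (m, c) = X $$ (r, m) * Y $$ (m, c)" if "m < d" for m
      using X' Y' rc that True by (cases "b m" "b r" rule: linorder_cases) auto
    with True show ?thesis by simp
  next
    case False
    then have "X' $$ (r, m) * Y' $$ (m, c) = 0" if "m < d" for m
      using X' Y' rc that by auto
    then have "(\<Sum>m = 0..<d. X' $$ (r, m) * Y' $$ (m, c)) = 0" by (intro sum.neutral) simp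
    with False show ?thesis by simp
  qed
  show ?thesis
    using X' Y' zero diag by (auto simp: diagonal_part_def entry simp del: index_mult_mat(1))
qed

text \<open>
  Conjugation by the diagonal matrix with entries \<open>t ^ b r\<close>: the block in position \<open>(j, k)\<close>
  is multiplied by \<open>t ^ k / t ^ j\<close>.
\<close>

definition block_scale :: "(nat \<Rightarrow> nat) \<Rightarrow> nat \<Rightarrow> real \<Rightarrow> real mat \<Rightarrow> real mat" where
  "block_scale b d t X = mat d d (\<lambda>(r, c). t ^ b c / t ^ b r * X $$ (r, c))"

lemma block_scale_carrier [simp]: "block_scale b d t X \<in> carrier_mat d d"
  by (simp add: block_scale_def)

lemma block_scale_index:
  "r < d \<Longrightarrow> c < d \<Longrightarrow> block_scale b d t X $$ (r, c) = t ^ b c / t ^ b r * X $$ (r, c)"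
  by (simp add: block_scale_def)

lemma block_scale_mult:
  assumes "t \<noteq> 0" "X \<in> carrier_mat d d" "Y \<in> carrier_mat d d"
  shows "block_scale b d t (X * Y) = block_scale b d t X * block_scale b d t Y"
proof (rule eq_matI)
  fix r c assume "r < dim_row (block_scale b d t X * block_scale b d t Y)"
    "c < dim_col (block_scale b d t X * block_scale b d t Y)"
  then have rc: "r < d" "c < d" by (auto simp: block_scale_def)
  have factor: "t ^ b c / t ^ b r * (X $$ (r, m) * Y $$ (m, c)) =
      (t ^ b m / t ^ b r * X $$ (r, m)) * (t ^ b c / t ^ b m * Y $$ (m, c))" for m
    using assms(1) by (simp add: field_simps)
  have "block_scale b d t (X * Y) $$ (r, c) =
      t ^ b c / t ^ b r * (\<Sum>m = 0..<d. X $$ (r, m) * Y $$ (m, c))"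
    using rc assms(2,3) by (simp add: block_scale_def scalar_prod_def)
  also have "\<dots> = (block_scale b d t X * block_scale b d t Y) $$ (r, c)"
    unfolding sum_distrib_left factor using rc by (simp add: block_scale_def scalar_prod_def)
  finally show "block_scale b d t (X * Y) $$ (r, c) = (block_scale b d t X * block_scale b d t Y) $$ (r, c)" .
qed (simp_all add: block_scale_def)

lemma minor_block_scale:
  assumes f: "\<And>i. i < k \<Longrightarrow> f i < d" and g: "\<And>i. i < k \<Longrightarrow> g i < d"
  shows "minor k (block_scale b d t X) f g =
    t ^ (\<Sum>i = 0..<k. b (g i)) / t ^ (\<Sum>i = 0..<k. b (f i)) * minor k X f g"
proof -
  have "(\<Prod>i = 0..<k. block_scale b d t X $$ (f i, g (p i))) =
      t ^ (\<Sum>i = 0..<k. b (g i)) / t ^ (\<Sum>i = 0..<k. b (f i)) * (\<Prod>i = 0..<k. X $$ (f i, g (p i)))"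
    if p: "p permutes {0..<k}" for p
  proof -
    have "(\<Prod>i = 0..<k. block_scale b d t X $$ (f i, g (p i))) =
        (\<Prod>i = 0..<k. t ^ b (g (p i)) / t ^ b (f i) * X $$ (f i, g (p i)))"
      using f g permutes_in_image[OF p] by (intro prod.cong) (auto simp: block_scale_def)
    also have "\<dots> = t ^ (\<Sum>i = 0..<k. b (g (p i))) / t ^ (\<Sum>i = 0..<k. b (f i)) *
        (\<Prod>i = 0..<k. X $$ (f i, g (p i)))"
      by (simp add: prod.distrib prod_dividef power_sum)
    also have "(\<Sum>i = 0..<k. b (g (p i))) = (\<Sum>i = 0..<k. b (g i))"
      using sum.permute[OF p, of "\<lambda>i. b (g i)"] by (simp add: comp_def)
    finally show ?thesis .
  qed
  then show ?thesis
    unfolding minor_leibniz sum_distrib_left by (intro sum.cong) (auto simp: mult_ac)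
qed

lemma tendsto_power_at_right_0:
  assumes "0 < n"
  shows "((\<lambda>t::real. t ^ n) \<longlongrightarrow> 0) (at_right 0)"
proof -
  have "((\<lambda>t::real. t ^ n) \<longlongrightarrow> 0 ^ n) (at_right 0)" by (intro tendsto_intros)
  then show ?thesis using assms by (simp add: zero_power)
qed

lemma eventually_power_quotient:
  assumes "(q::nat) \<le> p"
  shows "\<forall>\<^sub>F t in at_right (0::real). t ^ p / t ^ q = t ^ (p - q)"
  using eventually_at_right_less[of "0::real"]
  by eventually_elim (use assms in \<open>simp add: power_diff\<close>)

lemma minor_block_scale_tendsto:
  assumes XY: "diagonal_part b d X Y"
    and f: "\<And>i. i < k \<Longrightarrow> f i < d" and g: "\<And>i. i < k \<Longrightarrow> g i < d"
  shows "((\<lambda>t. minor k (block_scale b d t X) f g) \<longlongrightarrow> minor k Y f g) (at_right 0)"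
proof -
  note XY' = XY[unfolded diagonal_part_def]
  have entry: "((\<lambda>t. block_scale b d t X $$ (r, c)) \<longlongrightarrow> Y $$ (r, c)) (at_right 0)"
    if rc: "r < d" "c < d" for r c
  proof (cases "b r \<le> b c")
    case True
    have "((\<lambda>t. t ^ (b c - b r) * X $$ (r, c)) \<longlongrightarrow> Y $$ (r, c)) (at_right 0)"
    proof (cases "b r = b c")
      case False
      then show ?thesis
        using tendsto_mult_left_zero[OF tendsto_power_at_right_0[of "b c - b r"], of "X $$ (r, c)"] True XY' rc by simp
    qed (use XY' rc in simp)
    moreover have "\<forall>\<^sub>F t in at_right 0. t ^ (b c - b r) * X $$ (r, c) = block_scale b d t X $$ (r, c)"
      using eventually_power_quotient[OF True]
      by eventually_elim (simp only: block_scale_index[OF rc])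
    ultimately show ?thesis by (rule Lim_transform_eventually)
  next
    case False
    then show ?thesis using XY' rc by (simp add: block_scale_def)
  qed
  show ?thesis
    unfolding minor_leibniz
    by (intro tendsto_sum tendsto_mult tendsto_const tendsto_prod entry f)
      (use g permutes_in_image in fastforce)+
qed

text \<open>
  With equal block sums the conjugation does not change the minor at all, whereas the conjugated matrices
  converge to the diagonal part.
\<close>

lemma minor_diagonal_part_eq:
  assumes XY: "diagonal_part b d X Y"
    and f: "\<And>i. i < k \<Longrightarrow> f i < d" and g: "\<And>i. i < k \<Longrightarrow> g i < d"
    and eq: "(\<Sum>i = 0..<k. b (f i)) = (\<Sum>i = 0..<k. b (g i))"
  shows "minor k Y f g = minor k X f g"
proof -
  have lim: "((\<lambda>t. minor k (block_scale b d t X) f g) \<longlongrightarrow> minor k Y f g) (at_right 0)"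
    by (rule minor_block_scale_tendsto[OF XY f g])
  have "\<forall>\<^sub>F t in at_right 0. minor k (block_scale b d t X) f g = minor k X f g"
    using eventually_at_right_less[of "0::real"]
    by eventually_elim (simp add: minor_block_scale[OF f g] eq)
  then have "((\<lambda>t. minor k X f g) \<longlongrightarrow> minor k Y f g) (at_right (0::real))"
    by (rule Lim_transform_eventually[OF lim])
  then show ?thesis by (simp add: tendsto_const_iff)
qed

text \<open>
  With \<open>p\<close> and \<open>q\<close> the block sums over the columns and over the rows, the conjugated minor
  equals \<open>t ^ p / t ^ q\<close> times the original one, and it converges to the minor of \<open>Y\<close>. If
  \<open>q < p\<close> the factor tends to \<open>0\<close>. If \<open>p < q\<close> the factor is unbounded, so convergence forces
  the original minor to vanish.
\<close>

lemma minor_diagonal_part_zero: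
  assumes XY: "diagonal_part b d X Y"
    and f: "\<And>i. i < k \<Longrightarrow> f i < d" and g: "\<And>i. i < k \<Longrightarrow> g i < d"
    and ne: "(\<Sum>i = 0..<k. b (f i)) \<noteq> (\<Sum>i = 0..<k. b (g i))"
  shows "minor k Y f g = 0"
proof -
  define p where "p = (\<Sum>i = 0..<k. b (g i))"
  define q where "q = (\<Sum>i = 0..<k. b (f i))"
  have lim: "((\<lambda>t. minor k (block_scale b d t X) f g) \<longlongrightarrow> minor k Y f g) (at_right 0)"
    by (rule minor_block_scale_tendsto[OF XY f g])
  have scale: "minor k (block_scale b d t X) f g = t ^ p / t ^ q * minor k X f g" for t
    unfolding p_def q_def by (rule minor_block_scale[OF f g])
  have "q \<noteq> p" using ne by (simp add: p_def q_def)
  then consider "q < p" | "p < q" by linarith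
  then show ?thesis
  proof cases
    case 1
    have "((\<lambda>t. t ^ (p - q) * minor k X f g) \<longlongrightarrow> 0) (at_right 0)"
      using 1 tendsto_mult_left_zero[OF tendsto_power_at_right_0[of "p - q"]] by simp
    moreover have "\<forall>\<^sub>F t in at_right 0. t ^ (p - q) * minor k X f g = minor k (block_scale b d t X) f g"
      using eventually_power_quotient[OF less_imp_le[OF 1]]
      by eventually_elim (simp only: scale)
    ultimately have "((\<lambda>t. minor k (block_scale b d t X) f g) \<longlongrightarrow> 0) (at_right 0)"
      by (rule Lim_transform_eventually)
    with lim show ?thesis by (rule tendsto_unique[rotated]) simp
  next
    case 2
    have "((\<lambda>t. t ^ (q - p) * minor k (block_scale b d t X) f g) \<longlongrightarrow> 0 * minor k Y f g) (at_right 0)"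
      using 2 by (intro tendsto_mult lim tendsto_power_at_right_0) simp
    moreover have "\<forall>\<^sub>F t in at_right 0. t ^ (q - p) * minor k (block_scale b d t X) f g = minor k X f g"
      using eventually_at_right_less[of "0::real"]
      by eventually_elim (use 2 in \<open>simp add: scale power_diff\<close>)
    ultimately have "((\<lambda>t. minor k X f g) \<longlongrightarrow> 0 * minor k Y f g) (at_right (0::real))"
      by (rule Lim_transform_eventually)
    then have "minor k X f g = 0" by (simp add: tendsto_const_iff)
    then have "minor k (block_scale b d t X) f g = 0" for t by (simp add: scale)
    with lim show ?thesis by (simp add: tendsto_const_iff)
  qed
qed

lemma minors_sq_diagonal_part:
  assumes XY: "diagonal_part b d X Y"
  shows "minors_sq d k Y \<le> minors_sq d k X"
proof -
  have "(minor k Y f g)\<^sup>2 \<le> (minor k X f g)\<^sup>2"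
    if "f \<in> index_tuples k d" "g \<in> index_tuples k d" for f g
    using minor_diagonal_part_eq[OF XY, of k f g] minor_diagonal_part_zero[OF XY, of k f g]
      index_tuples_lt that by (cases "(\<Sum>i = 0..<k. b (f i)) = (\<Sum>i = 0..<k. b (g i))") auto
  then show ?thesis unfolding minors_sq_def by (intro sum_mono)
qed

lemma det_diagonal_part:
  assumes XY: "diagonal_part b d X Y"
  shows "det Y = det X"
proof -
  have "det Z = minor d Z (\<lambda>i. i) (\<lambda>i. i)" if "Z \<in> carrier_mat d d" for Z
  proof -
    have "mat d d (\<lambda>(i, j). Z $$ (i, j)) = Z" using that by (intro eq_matI) auto
    then show ?thesis by (simp add: minor_def)
  qed
  then show ?thesis
    using minor_diagonal_part_eq[OF XY, of d "\<lambda>i. i" "\<lambda>i. i"] XY by (simp add: diagonal_part_def)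
qed

text \<open>
  Undoing the conjugation costs at most a factor that depends on \<open>t\<close> but not on \<open>X\<close>, so it is invisible to growth
  rates.
\<close>

lemma minors_sq_le_block_scale:
  assumes t: "0 < t" "t \<le> 1" and M: "\<And>r. r < d \<Longrightarrow> b r \<le> M" and j: "j \<le> k"
  shows "minors_sq d j X \<le> (1 / t ^ (k * M))\<^sup>2 * minors_sq d j (block_scale b d t X)"
proof -
  have "(minor j X f g)\<^sup>2 \<le> (1 / t ^ (k * M))\<^sup>2 * (minor j (block_scale b d t X) f g)\<^sup>2"
    if "f \<in> index_tuples j d" "g \<in> index_tuples j d" for f g
  proof -
    define p where "p = (\<Sum>i = 0..<j. b (g i))"
    define q where "q = (\<Sum>i = 0..<j. b (f i))"
    have eq: "minor j (block_scale b d t X) f g = t ^ p / t ^ q * minor j X f g"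
      unfolding p_def q_def using that index_tuples_lt by (intro minor_block_scale) auto
    have "p \<le> (\<Sum>i = 0..<j. M)"
      unfolding p_def using M index_tuples_lt[OF that(2)] by (intro sum_mono) auto
    then have "p \<le> k * M" using j by (simp add: order_trans[OF _ mult_le_mono1])
    then have "t ^ (k * M) \<le> t ^ p" using t by (intro power_decreasing) auto
    moreover have "t ^ q \<le> 1" using t by (simp add: power_le_one)
    ultimately have "t ^ (k * M) * t ^ q \<le> t ^ p * 1"
      using t by (intro mult_mono) auto
    then have "1 \<le> 1 / t ^ (k * M) * (t ^ p / t ^ q)"
      using t by (simp add: field_simps)
    then have "1 * (minor j X f g)\<^sup>2 \<le> (1 / t ^ (k * M) * (t ^ p / t ^ q))\<^sup>2 * (minor j X f g)\<^sup>2"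
      by (intro mult_right_mono) auto
    also have "\<dots> = (1 / t ^ (k * M))\<^sup>2 * (minor j (block_scale b d t X) f g)\<^sup>2"
      unfolding eq by (simp add: power_mult_distrib power_divide)
    finally show ?thesis by simp
  qed
  then show ?thesis
    unfolding minors_sq_def sum_distrib_left by (intro sum_mono)
qed

lemma log_minors_block_scale_tendsto:
  assumes XY: "diagonal_part b d X Y"
    and pos: "\<And>k. k \<in> {nat \<lfloor>s\<rfloor>, Suc (nat \<lfloor>s\<rfloor>)} \<Longrightarrow> 0 < minors_sq d k Y"
  shows "((\<lambda>t. log_minors d s (block_scale b d t X)) \<longlongrightarrow> log_minors d s Y) (at_right 0)"
proof -
  have "((\<lambda>t. minors_sq d k (block_scale b d t X)) \<longlongrightarrow> minors_sq d k Y) (at_right 0)" for k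
    unfolding minors_sq_def
    by (intro tendsto_sum tendsto_power minor_block_scale_tendsto[OF XY]) (auto dest: index_tuples_lt)
  then show ?thesis
    unfolding log_minors_def Let_def
    using pos[of "nat \<lfloor>s\<rfloor>"] pos[of "Suc (nat \<lfloor>s\<rfloor>)"] by (intro tendsto_intros) auto
qed

section \<open>Equality of the growth rates\<close>

lemma word_mat_Nil: "word_mat d A [] = 1\<^sub>m d"
  by (simp add: word_mat_def)

lemma word_mat_Cons: "word_mat d A (i # w) = A i * word_mat d A w"
  by (simp add: word_mat_def)

lemma all_words_simps [simp]: "[] \<in> all_words N" "i # w \<in> all_words N \<longleftrightarrow> i \<in> {1..N} \<and> w \<in> all_words N"
  by (auto simp: all_words_def)

lemma word_mat_GL:
  assumes "\<forall>i\<in>{1..N}. A i \<in> GL d" "w \<in> all_words N"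
  shows "word_mat d A w \<in> GL d"
  using assms(2)
proof (induction w)
  case (Cons i w)
  then show ?case using bspec[OF assms(1), of i] by (auto simp: word_mat_Cons GL_det det_mult)
qed (simp add: word_mat_Nil GL_det)

lemma word_mat_append:
  assumes "\<forall>i\<in>{1..N}. A i \<in> GL d" "u \<in> all_words N" "v \<in> all_words N"
  shows "word_mat d A (u @ v) = word_mat d A u * word_mat d A v"
  using assms(2)
proof (induction u)
  case Nil
  then show ?case
    using word_mat_GL[OF assms(1,3)] by (simp add: word_mat_Nil GL_det left_mult_one_mat[of _ d d])
next
  case (Cons i u)
  then show ?case
    using bspec[OF assms(1), of i] word_mat_GL[OF assms(1), of u] word_mat_GL[OF assms(1,3)]
    by (auto simp: word_mat_Cons GL_det assoc_mult_mat[of _ d d _ d _ d])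
qed

lemma diagonal_part_word_mat:
  assumes "\<forall>i\<in>{1..N}. diagonal_part b d (A i) (A' i)" "w \<in> all_words N"
  shows "diagonal_part b d (word_mat d A w) (word_mat d A' w)"
  using assms(2)
  by (induction w) (simp_all add: word_mat_Nil word_mat_Cons diagonal_part_one diagonal_part_mult bspec[OF assms(1)])

lemma diagonal_part_GL:
  assumes "diagonal_part b d X Y" "X \<in> GL d"
  shows "Y \<in> GL d"
  using assms det_diagonal_part[OF assms(1)] by (simp add: GL_det diagonal_part_def)

text \<open>
  The potential supplied to \<open>averaging_growth_eq\<close> for given \<open>n\<close> and \<open>e\<close> is that of the conjugated matrices, with \<open>t\<close>
  small enough to be within \<open>e\<close> of the diagonal part on the finitely many words of length \<open>n\<close>.
\<close>

lemma svf_growth_diagonal_part: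
  assumes F: "averaging N F" and s: "0 \<le> s" "s < real d"
    and A: "\<forall>i\<in>{1..N}. A i \<in> GL d"
    and diag: "\<forall>i\<in>{1..N}. diagonal_part b d (A i) (A' i)"
  shows "(\<lambda>n. F n (\<lambda>w. ln (svf s (word_mat d A w))) / real n) \<longlonglongrightarrow> L \<longleftrightarrow>
    (\<lambda>n. F n (\<lambda>w. ln (svf s (word_mat d A' w))) / real n) \<longlonglongrightarrow> L"
proof -
  define k where "k = nat \<lfloor>s\<rfloor>"
  have k: "k < d" using floor_index_less[OF s] by (simp add: k_def)
  have A': "\<forall>i\<in>{1..N}. A' i \<in> GL d"
    using diagonal_part_GL diag A by blast
  have pos: "0 < minors_sq d j X" if "X \<in> GL d" "j \<in> {k, Suc k}" for j X
    using that k by (intro minors_sq_pos) auto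
  define a where "a = (\<lambda>w. log_minors d s (word_mat d A w))"
  define a' where "a' = (\<lambda>w. log_minors d s (word_mat d A' w))"
  obtain K where K: "\<And>X. X \<in> GL d \<Longrightarrow> \<bar>ln (svf s X) - log_minors d s X\<bar> \<le> K"
    using ln_svf_log_minors[OF s] by blast
  have replace: "(\<lambda>n. F n (\<lambda>w. ln (svf s (word_mat d B w))) / real n) \<longlonglongrightarrow> L \<longleftrightarrow>
      (\<lambda>n. F n (\<lambda>w. log_minors d s (word_mat d B w)) / real n) \<longlonglongrightarrow> L"
    if B: "\<forall>i\<in>{1..N}. B i \<in> GL d" for B
  proof (rule tendsto_div_nat_cong)
    fix n
    have close: "\<bar>ln (svf s (word_mat d B w)) - log_minors d s (word_mat d B w)\<bar> \<le> K"
      if "w \<in> words N n" for w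
      using K word_mat_GL[OF B words_all_words[OF that]] by blast
    have "F n (\<lambda>w. ln (svf s (word_mat d B w))) \<le> F n (\<lambda>w. log_minors d s (word_mat d B w)) + K"
      "F n (\<lambda>w. log_minors d s (word_mat d B w)) \<le> F n (\<lambda>w. ln (svf s (word_mat d B w))) + K"
      using close by (intro averaging_mono[OF F]; fastforce simp: abs_le_iff)+
    then show "\<bar>F n (\<lambda>w. ln (svf s (word_mat d B w))) - F n (\<lambda>w. log_minors d s (word_mat d B w))\<bar> \<le> K"
      by linarith
  qed
  have "(\<lambda>n. F n a / real n) \<longlonglongrightarrow> L \<longleftrightarrow> (\<lambda>n. F n a' / real n) \<longlonglongrightarrow> L"
  proof (rule averaging_growth_eq[OF F])
    fix w assume w: "w \<in> all_words N"
    show "a' w \<le> a w"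
      using log_minors_mono[of s 1 d "word_mat d A' w" "word_mat d A w"] s
        pos[OF word_mat_GL[OF A' w]] minors_sq_diagonal_part[OF diagonal_part_word_mat[OF diag w]]
      by (simp add: a_def a'_def k_def)
  next
    fix n :: nat and e :: real assume e: "0 < e"
    \<comment> \<open>Convergence to the diagonal part is uniform over the finitely many words of length \<open>n\<close>.\<close>
    have "\<forall>\<^sub>F t in at_right 0. \<forall>w\<in>words N n. log_minors d s (block_scale b d t (word_mat d A w)) < a' w + e"
    proof (intro eventually_ball_finite ballI)
      fix w assume "w \<in> words N n"
      then have w: "w \<in> all_words N" by (rule words_all_words)
      have "((\<lambda>t. log_minors d s (block_scale b d t (word_mat d A w))) \<longlongrightarrow> a' w) (at_right 0)"
        unfolding a'_def
        using pos[OF word_mat_GL[OF A' w]] diagonal_part_word_mat[OF diag w]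
        by (intro log_minors_block_scale_tendsto) (auto simp: k_def)
      then show "\<forall>\<^sub>F t in at_right 0. log_minors d s (block_scale b d t (word_mat d A w)) < a' w + e"
        by (rule order_tendstoD) (use e in simp)
    qed simp
    moreover have "\<forall>\<^sub>F t in at_right 0. t \<in> {0<..<1::real}"
      by (rule eventually_at_right_real) simp
    ultimately have "\<forall>\<^sub>F t in at_right 0. (\<forall>w\<in>words N n.
        log_minors d s (block_scale b d t (word_mat d A w)) < a' w + e) \<and> t \<in> {0<..<1}"
      by (rule eventually_conj)
    then have "\<exists>t. (\<forall>w\<in>words N n.
        log_minors d s (block_scale b d t (word_mat d A w)) < a' w + e) \<and> t \<in> {0<..<1}"
      by (rule eventually_happens'[OF trivial_limit_at_right_real])
    then obtain t where near: "\<forall>w\<in>words N n.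
        log_minors d s (block_scale b d t (word_mat d A w)) < a' w + e" and "t \<in> {0<..<1}"
      by blast
    then have t: "0 < t" "t < 1" by simp_all
    define M where "M = Max (b ` {..<d})"
    have M: "b r \<le> M" if "r < d" for r unfolding M_def using that by (intro Max_ge) auto
    \<comment> \<open>One factor that serves for both \<open>k\<close>-minors and \<open>(k + 1)\<close>-minors.\<close>
    define c where "c = (1 / t ^ (Suc k * M))\<^sup>2"
    have c: "0 < c" using t by (simp add: c_def)
    have scale_bound: "minors_sq d j X \<le> c * minors_sq d j (block_scale b d t X)" if "j \<in> {k, Suc k}" for j X
      unfolding c_def using t that by (intro minors_sq_le_block_scale M) auto
    have scale_pos: "0 < minors_sq d j (block_scale b d t X)" if "X \<in> GL d" "j \<in> {k, Suc k}" for j X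
      using less_le_trans[OF pos[OF that] scale_bound[OF that(2)]] c by (simp add: zero_less_mult_iff)
    let ?b = "\<lambda>w. log_minors d s (block_scale b d t (word_mat d A w))"
    have "subadditive_potential N ?b"
      unfolding subadditive_potential_def
    proof (intro ballI)
      fix u v assume uv: "u \<in> all_words N" "v \<in> all_words N"
      note G = word_mat_GL[OF A uv(1)] word_mat_GL[OF A uv(2)]
      have "u @ v \<in> all_words N" using uv by (simp add: all_words_def)
      note Guv = word_mat_GL[OF A this]
      have eq: "block_scale b d t (word_mat d A (u @ v)) =
          block_scale b d t (word_mat d A u) * block_scale b d t (word_mat d A v)"
        using t G unfolding word_mat_append[OF A uv] by (intro block_scale_mult) (auto simp: GL_det)
      show "?b (u @ v) \<le> ?b u + ?b v"
        unfolding eq using s scale_pos[OF Guv] by (intro log_minors_mult) (auto simp: k_def eq)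
    qed
    moreover have "\<forall>w\<in>words N n. ?b w \<le> a' w + e" using near by (simp add: less_imp_le)
    moreover have "a w \<le> ?b w + ln c / 2" if w: "w \<in> all_words N" for w
      using log_minors_mono[OF s(1) c, of d "word_mat d A w" "block_scale b d t (word_mat d A w)"]
        pos[OF word_mat_GL[OF A w]] scale_bound by (simp add: a_def k_def)
    ultimately show "\<exists>b C. subadditive_potential N b \<and> (\<forall>w\<in>words N n. b w \<le> a' w + e) \<and>
        (\<forall>w\<in>all_words N. a w \<le> b w + C)"
      by blast
  qed
  then show ?thesis using replace[OF A] replace[OF A'] by (simp add: a_def a'_def)
qed

text \<open>
  The value of \<open>lim\<close> is determined by the set of limits, also when that set is empty.
\<close>

lemma lim_cong_convergence:
  fixes x y :: "nat \<Rightarrow> real"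
  shows "(\<And>L. x \<longlonglongrightarrow> L \<longleftrightarrow> y \<longlonglongrightarrow> L) \<Longrightarrow> lim x = lim y"
  by (simp add: lim_def)

lemma pressure_diagonal_part:
  assumes N: "1 \<le> N" and s: "0 \<le> s" "s < real d"
    and A: "\<forall>i\<in>{1..N}. A i \<in> GL d"
    and diag: "\<forall>i\<in>{1..N}. diagonal_part b d (A i) (A' i)"
  shows "pressure N d s A = pressure N d s A'"
proof -
  have A': "\<forall>i\<in>{1..N}. A' i \<in> GL d"
    using diagonal_part_GL diag A by blast
  have svf_exp: "(\<Sum>w\<in>words N n. svf s (word_mat d B w)) =
      (\<Sum>w\<in>words N n. exp (ln (svf s (word_mat d B w))))"
    if "\<forall>i\<in>{1..N}. B i \<in> GL d" for B n
    using svf_pos[OF word_mat_GL[OF that words_all_words] s] by (intro sum.cong) auto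
  show ?thesis
    unfolding pressure_def
  proof (rule lim_cong_convergence)
    fix L
    show "(\<lambda>n. 1 / real n * ln (\<Sum>w\<in>words N n. svf s (word_mat d A w))) \<longlonglongrightarrow> L \<longleftrightarrow>
        (\<lambda>n. 1 / real n * ln (\<Sum>w\<in>words N n. svf s (word_mat d A' w))) \<longlonglongrightarrow> L"
      using svf_growth_diagonal_part[OF averaging_log_partition[OF N] s A diag, of L]
      by (simp add: svf_exp[OF A] svf_exp[OF A'])
  qed
qed

lemma lyapunov_diagonal_part:
  assumes mu: "\<mu> \<in> invariant_measures N" and s: "0 \<le> s" "s < real d"
    and A: "\<forall>i\<in>{1..N}. A i \<in> GL d"
    and diag: "\<forall>i\<in>{1..N}. diagonal_part b d (A i) (A' i)"
  shows "lyapunov N d s A \<mu> = lyapunov N d s A' \<mu>"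
  unfolding lyapunov_def
  using svf_growth_diagonal_part[OF averaging_integral[OF mu] s A diag]
  by (intro lim_cong_convergence) simp

section \<open>Equilibrium states of block triangular systems\<close>

lemma block_index_bounds:
  assumes "r < sum_list ds"
  shows "block_index ds r < length ds" "block_offset ds (block_index ds r) \<le> r"
    "r - block_offset ds (block_index ds r) < ds ! block_index ds r"
proof -
  let ?j = "block_index ds r"
  have ex: "r < block_offset ds (Suc (length ds))" using assms by (simp add: block_offset_def)
  have up: "r < block_offset ds (Suc ?j)"
    unfolding block_index_def by (rule LeastI[of "\<lambda>j. r < block_offset ds (Suc j)"]) (rule ex)
  show low: "block_offset ds ?j \<le> r"
  proof (cases ?j)
    case 0
    then show ?thesis by (simp add: block_offset_def)
  next
    case (Suc i)
    then have "\<not> r < block_offset ds (Suc i)"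
      unfolding block_index_def by (metis lessI not_less_Least)
    with Suc show ?thesis by simp
  qed
  show j: "?j < length ds"
  proof (rule ccontr)
    assume "\<not> ?j < length ds"
    then have "block_offset ds ?j = sum_list ds" by (simp add: block_offset_def)
    with low assms show False by simp
  qed
  show "r - block_offset ds ?j < ds ! ?j" using up low block_offset_Suc[OF j] by simp
qed

lemma diagonal_part_block_mat:
  fixes B :: "nat \<Rightarrow> nat \<Rightarrow> real mat"
  shows "diagonal_part (block_index ds) (sum_list ds)
    (block_mat ds (\<lambda>j k. if j \<le> k then B j k else 0\<^sub>m (ds ! j) (ds ! k)))
    (block_mat ds (\<lambda>j k. if j = k then B j k else 0\<^sub>m (ds ! j) (ds ! k)))"
  using block_index_bounds
  by (auto simp: diagonal_part_def block_mat_def Let_def)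

theorem theorem5:
  fixes N d :: nat and s :: real
    and A A' :: "nat \<Rightarrow> real mat"
    and ds :: "nat list"
    and B :: "nat \<Rightarrow> nat \<Rightarrow> nat \<Rightarrow> real mat"
  assumes "2 \<le> N"
    and "\<forall>i\<in>{1..N}. A i \<in> GL d"
    and "0 < s" and "s < real d"
    and "\<forall>m\<in>set ds. 0 < m" and "sum_list ds = d"
    and "\<forall>i\<in>{1..N}. \<forall>j k. j \<le> k \<and> k < length ds \<longrightarrow> B i j k \<in> carrier_mat (ds ! j) (ds ! k)"
    and "\<forall>i\<in>{1..N}. A i =
           block_mat ds (\<lambda>j k. if j \<le> k then B i j k else 0\<^sub>m (ds ! j) (ds ! k))"
    and "\<forall>i\<in>{1..N}. A' i =
           block_mat ds (\<lambda>j k. if j = k then B i j k else 0\<^sub>m (ds ! j) (ds ! k))"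
  shows "(\<forall>i\<in>{1..N}. A' i \<in> GL d) \<and>
    equilibrium_states N d s A = equilibrium_states N d s A'"
proof -
  note A = assms(2)
  have diag: "\<forall>i\<in>{1..N}. diagonal_part (block_index ds) d (A i) (A' i)"
  proof
    fix i assume i: "i \<in> {1..N}"
    show "diagonal_part (block_index ds) d (A i) (A' i)"
      using diagonal_part_block_mat[of ds "B i"] by (simp only: bspec[OF assms(8) i] bspec[OF assms(9) i] assms(6))
  qed
  have s: "0 \<le> s" "s < real d" using assms(3,4) by simp_all
  have "pressure N d s A = pressure N d s A'"
    using assms(1) by (intro pressure_diagonal_part[OF _ s A diag]) auto
  moreover have "lyapunov N d s A \<mu> = lyapunov N d s A' \<mu>" if "\<mu> \<in> invariant_measures N" for \<mu>
    by (rule lyapunov_diagonal_part[OF that s A diag])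
  ultimately have "equilibrium_states N d s A = equilibrium_states N d s A'"
    by (auto simp: equilibrium_states_def)
  then show ?thesis using diagonal_part_GL diag A by blast
qed

end
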